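(* Let $d\ge 1$, $w_1,\dots,w_d\in\mathcal H$, $\bm w=(w_1,\dots,w_d)$, and let $q\in\{1,\dots,d\}$. Then the finite part at $\alpha=q$ of the homogeneous Barnes zeta function is $$\begin{aligned} F.P.[\zeta_{\rm Bh}(\alpha|\bm w)]_{\alpha=q}={}&\frac{(-1)^q}{(q-1)!}\sum_{m=0}^{d-q}\frac{{}_dS_m^{(d)}(0)}{m!\,(d-q-m)!}F\bigl[x^{d-q-m}\log x\bigr]_{x=\bm w}+\frac{{}_dS_{d-q}^{(d)}(0)\,(-1)^{d+q+1}}{(q-1)!\,(d-q)!}H_{q-1}\\ &+\sum_{\bm n\in\mathbb N_0^d\setminus\{\bm 0\}}\Biggl[\frac{1}{(\bm n\cdot\bm w)^q}+\frac{(-1)^q}{(q-1)!}\sum_{m=0}^{d-q}\frac{{}_dS_m^{(d)}(0)}{m!\,(d-q-m)!}\\ &\qquad\times G\bigl[(\bm n\cdot\bm w+x)^{d-q-m}\log(\bm n\cdot\bm w+x)\bigr]_{x=\bm w}\Biggr]. \end{aligned}$$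
   Context: $\mathcal H=\{z\in\mathbb C:\theta-\frac{\pi}{2}<\arg z<\theta+\frac{\pi}{2}\}$ is a fixed open half-plane ($\theta$ a fixed real angle), and $\log$ is a fixed holomorphic branch of the logarithm on $\mathcal H$; $z^s=\exp(s\log z)$ for $z\in\mathcal H$. $\mathbb N_0=\{0,1,2,\dots\}$ and $\bm n\cdot\bm w=\sum_{i=1}^d n_iw_i$. The homogeneous Barnes zeta function is $\zeta_{\rm Bh}(\alpha|\bm w)=\sum_{\bm n\in\mathbb N_0^d\setminus\{\bm 0\}}(\bm n\cdot\bm w)^{-\alpha}$ for $\Re(\alpha)>d$; it extends meromorphically in $\alpha$ to $\mathbb C$, with at most simple poles, located at $\alpha=1,\dots,d$. $F.P.[f(\alpha)]_{\alpha=q}$ denotes the constant term of the Laurent expansion of $f$ at $\alpha=q$. For $\bm v\in\mathbb C^d$ and a function $g$ of $x$, $F[g(x)]_{x=\bm v}=\sum_{\emptyset\ne S\subseteq\{1,\dots,d\}}(-1)^{d-|S|}g\bigl(\sum_{i\in S}v_i\bigr)$ and $G[g(x)]_{x=\bm v}=(-1)^dg(0)+F[g(x)]_{x=\bm v}$. Harmonic numbers: $H_k=\sum_{i=1}^k 1/i$, $H_0=0$. The higher order Bernoulli polynomials $B_n(a|\bm w)$ are defined by $z^d{\rm e}^{az}\prod_{i=1}^d\frac{w_i}{{\rm e}^{w_iz}-1}=\sum_{n\ge0}B_n(a|\bm w)\frac{z^n}{n!}$ for $|z|<2\pi/\max_i|w_i|$. The Bernoullian functions ${}_dS_n(a)$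 ($n\ge0$; dependence on $\bm w$ suppressed) are the polynomials in $a$ with ${}_dS_n(0)=0$ and ${}_dS_n'(a)=\frac{n!}{(n+d-1)!\,\prod_{i=1}^dw_i}B_{n+d-1}(a|\bm w)$; ${}_dS_m^{(d)}(0)$ is the $d$-th derivative in $a$ at $a=0$ (equivalently ${}_dS_m^{(d)}(0)=B_m(0|\bm w)/\prod_{i=1}^dw_i$). The sum over $\mathbb N_0^d\setminus\{\bm 0\}$ is understood as an unordered (absolutely convergent) sum of the bracketed terms. *)

theory Defs
  imports "HOL-Complex_Analysis.Complex_Analysis"
begin

text \<open>
  Vectors of length \<open>d\<close> are functions on \<open>nat\<close> of which only the components with index
  in \<open>{1..d}\<close> are used.
\<close>

(* z = 0 is excluded by hand, since is_Arg 0 t holds for every t. *)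
definition half_plane :: "real \<Rightarrow> complex set" where
  "half_plane \<theta> = {z. z \<noteq> 0 \<and> (\<exists>t. is_Arg z t \<and> \<theta> - pi / 2 < t \<and> t < \<theta> + pi / 2)}"

definition log_branch_on :: "(complex \<Rightarrow> complex) \<Rightarrow> complex set \<Rightarrow> bool" where
  "log_branch_on lg A \<longleftrightarrow> lg holomorphic_on A \<and> (\<forall>z\<in>A. exp (lg z) = z)"

definition dotp :: "nat \<Rightarrow> (nat \<Rightarrow> nat) \<Rightarrow> (nat \<Rightarrow> complex) \<Rightarrow> complex" where
  "dotp d n w = (\<Sum>i=1..d. of_nat (n i) * w i)"

(* Extensional functions, so that every nonzero tuple is represented exactly once. *)
definition nonzero_tuples :: "nat \<Rightarrow> (nat \<Rightarrow> nat) set" where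
  "nonzero_tuples d = {n \<in> {1..d} \<rightarrow>\<^sub>E UNIV. \<exists>i\<in>{1..d}. n i \<noteq> 0}"

text \<open>
  The homogeneous Barnes zeta function is the meromorphic function on the whole plane that is
  given by the Dirichlet series for \<open>Re \<alpha> > d\<close>. The condition \<open>nicely_meromorphic_on\<close> (removable
  singularities are removed and the value at a pole is the dummy value 0) makes it unique as a
  total function.
\<close>

definition barnes_zeta_hom ::
    "(complex \<Rightarrow> complex) \<Rightarrow> nat \<Rightarrow> (nat \<Rightarrow> complex) \<Rightarrow> complex \<Rightarrow> complex" where
  "barnes_zeta_hom lg d w =
     (THE Z. Z nicely_meromorphic_on UNIV \<and>
        (\<forall>\<alpha>. Re \<alpha> > real d \<longrightarrow>
           ((\<lambda>n. exp (- \<alpha> * lg (dotp d n w))) has_sum Z \<alpha>) (nonzero_tuples d)))"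

definition finite_part :: "(complex \<Rightarrow> complex) \<Rightarrow> complex \<Rightarrow> complex" where
  "finite_part f q = fls_nth (laurent_expansion f q) 0"

definition F_op :: "nat \<Rightarrow> (complex \<Rightarrow> complex) \<Rightarrow> (nat \<Rightarrow> complex) \<Rightarrow> complex" where
  "F_op d g v = (\<Sum>S\<in>{S. S \<subseteq> {1..d} \<and> S \<noteq> {}}. (-1) ^ (d - card S) * g (\<Sum>i\<in>S. v i))"

definition G_op :: "nat \<Rightarrow> (complex \<Rightarrow> complex) \<Rightarrow> (nat \<Rightarrow> complex) \<Rightarrow> complex" where
  "G_op d g v = (-1) ^ d * g 0 + F_op d g v"

(* For nonzero w i the denominator has order exactly d at 0, so this is an exact quotient of
   formal power series: the Taylor series at 0 of the generating function. *)
definition bernoulli_gf :: "nat \<Rightarrow> (nat \<Rightarrow> complex) \<Rightarrow> complex \<Rightarrow> complex fps" where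
  "bernoulli_gf d w a =
     (fps_X ^ d * fps_exp a * fps_const (\<Prod>i=1..d. w i)) / (\<Prod>i=1..d. fps_exp (w i) - 1)"

definition higher_bernoulli :: "nat \<Rightarrow> (nat \<Rightarrow> complex) \<Rightarrow> nat \<Rightarrow> complex \<Rightarrow> complex" where
  "higher_bernoulli d w n a = fact n * fps_nth (bernoulli_gf d w a) n"

definition bernoullian_poly :: "nat \<Rightarrow> (nat \<Rightarrow> complex) \<Rightarrow> nat \<Rightarrow> complex poly" where
  "bernoullian_poly d w n =
     (THE p. poly p 0 = 0 \<and>
        (\<forall>a. poly (pderiv p) a =
           fact n / (fact (n + d - 1) * (\<Prod>i=1..d. w i)) * higher_bernoulli d w (n + d - 1) a))"

definition bernoullian :: "nat \<Rightarrow> (nat \<Rightarrow> complex) \<Rightarrow> nat \<Rightarrow> complex \<Rightarrow> complex" where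
  "bernoullian d w n a = poly (bernoullian_poly d w n) a"

end

theory Submission
  imports Defs
begin

text \<open>
  Write \<open>D\<^sub>i g(y) = g(y + w\<^sub>i) - g(y)\<close>. Since \<open>\<Prod>D\<^sub>i = \<Prod>(exp (w\<^sub>i d/dy) - 1)\<close>, applying
  \<open>\<Prod>D\<^sub>i\<close> to \<open>P(y) = \<Sum>m\<le>K. u\<^sub>m (d/dy)^(m-d) y^(-\<alpha>)\<close>, where \<open>\<Sum>u\<^sub>m z^m = z^d / \<Prod>(exp (w\<^sub>i z) - 1)\<close>,
  gives \<open>y^(-\<alpha>) + O(y^(-\<alpha>-K-1))\<close>. Over the lattice points \<open>n \<noteq> 0\<close> the differences \<open>\<Prod>D\<^sub>i P(n\<cdot>w)\<close>
  telescope to \<open>-F[P]\<close>, so the zeta function equals \<open>-F[P]\<close> plus a series that converges for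
  \<open>Re \<alpha> > d - K - 1\<close>. Multiplied by \<open>\<Prod>j=1..d. j - \<alpha>\<close> everything becomes holomorphic, which gives
  the continuation; the formula is the case \<open>K = d - q\<close>, where finite parts can be taken term by
  term and polynomials of degree less than \<open>d\<close> are annihilated by \<open>\<Prod>D\<^sub>i\<close>.
\<close>

section \<open>General facts on series and meromorphic functions\<close>

text \<open>The d-fold primitive y^(d-\<alpha>) / \<Prod>(j-\<alpha>) has poles in \<alpha> at 1..d,
  exactly where finite parts are wanted. After clearing the product, the finite part at q is an
  ordinary derivative at q: that of the cleared function divided by the product stripped of its
  factor \<alpha>-q. The harmonic numbers are logarithmic derivatives of what remains of the
  product. The telescoping needs the lattice sum of y^(d-\<alpha>) to converge absolutely, hence Re
  \<alpha> > 2d; from there the identity theorem carries the result to the left. K = d - q is the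
  smallest K for which the half-plane Re \<alpha> > d-K-1 contains q. Sizes are measured by the
  projection Re (exp(-i\<theta>) y) instead of |y|: it is additive and positive on the w_i, so it
  never decreases under the shifts, and it turns lattice sums into sums with positive real
  weights.\<close>

lemma half_plane_iff: "z \<in> half_plane \<theta> \<longleftrightarrow> 0 < Re (cis (- \<theta>) * z)"
proof
  assume "z \<in> half_plane \<theta>"
  then obtain t where z: "z \<noteq> 0" and t: "is_Arg z t" "\<theta> - pi / 2 < t" "t < \<theta> + pi / 2"
    unfolding half_plane_def by blast
  have "cis (- \<theta>) * z = cis (- \<theta>) * (of_real (norm z) * cis t)"
    using t(1) unfolding is_Arg_def cis_conv_exp by (rule arg_cong)
  also have "\<dots> = of_real (norm z) * (cis (- \<theta>) * cis t)"
    by (rule mult.left_commute)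
  also have "\<dots> = of_real (norm z) * cis (t - \<theta>)"
    unfolding cis_mult by simp
  finally have "cis (- \<theta>) * z = of_real (norm z) * cis (t - \<theta>)" .
  moreover have "cos (t - \<theta>) > 0"
    using t by (intro cos_gt_zero_pi) auto
  ultimately show "0 < Re (cis (- \<theta>) * z)"
    using z by (simp add: cis.ctr)
next
  assume *: "0 < Re (cis (- \<theta>) * z)"
  define u where "u = cis (- \<theta>) * z"
  have u: "u \<noteq> 0" "Re u > 0" using * by (auto simp: u_def)
  have "\<bar>Arg u\<bar> < pi / 2"
    using u Arg_Re_pos[of u] by blast
  moreover have "is_Arg z (\<theta> + Arg u)"
  proof -
    have "z = (cis \<theta> * cis (- \<theta>)) * z"
      unfolding cis_mult by simp
    also have "\<dots> = cis \<theta> * u"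
      unfolding u_def by (rule mult.assoc)
    also have "u = of_real (norm u) * cis (Arg u)"
      using is_Arg_Arg[OF u(1)] unfolding is_Arg_def cis_conv_exp .
    also have "cis \<theta> * \<dots> = of_real (norm u) * (cis \<theta> * cis (Arg u))"
      by (rule mult.left_commute)
    also have "\<dots> = of_real (norm u) * cis (\<theta> + Arg u)"
      unfolding cis_mult ..
    also have "norm u = norm z"
      by (simp add: u_def norm_mult)
    finally show ?thesis
      unfolding is_Arg_def cis_conv_exp .
  qed
  moreover have "z \<noteq> 0" using * by auto
  ultimately show "z \<in> half_plane \<theta>"
    using u by (auto simp: half_plane_def intro!: exI[of _ "\<theta> + Arg u"])
qed

text \<open>With N the sum of the entries, the linear form is at least a multiple of 1 + N, and (1 +
  N) powr (-s) is a product of d equal factors (1 + N) powr (-s/d), each at most (1 + n i) powr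
  (-s/d). So the d-th power of a one-dimensional series with exponent s/d > 1 dominates.\<close>

lemma summable_on_inverse_power_sum:
  fixes c :: "nat \<Rightarrow> real"
  assumes "\<And>i. i \<in> {1..d} \<Longrightarrow> 0 < c i" and "s > real d"
  shows "(\<lambda>n. (\<Sum>i=1..d. real (n i) * c i) powr (-s)) summable_on nonzero_tuples d"
proof (cases "d = 0")
  case True
  thus ?thesis by (simp add: nonzero_tuples_def)
next
  case False
  define b where "b = Min (c ` {1..d})"
  have ne: "c ` {1..d} \<noteq> {}" using False by simp
  have b: "b > 0" "\<And>i. i \<in> {1..d} \<Longrightarrow> b \<le> c i"
    unfolding b_def using assms(1) ne by simp_all
  define p where "p = s / real d"
  have p: "p > 1" using assms(2) False by (simp add: p_def)
  have 1: "(\<lambda>k::nat. (1 + real k) powr (-p)) summable_on UNIV"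
  proof -
    have "summable (\<lambda>k. real k powr (-p))"
      using p by (subst summable_real_powr_iff) simp
    hence "summable (\<lambda>k. real (Suc k) powr (-p))"
      by (subst summable_Suc_iff)
    hence "summable (\<lambda>k. norm ((1 + real k) powr (-p)))"
      by (simp add: add.commute)
    thus ?thesis by (rule norm_summable_imp_summable_on)
  qed
  have "(\<lambda>n. \<Prod>i\<in>{1..d}. (1 + real (n i)) powr (-p)) summable_on ({1..d} \<rightarrow>\<^sub>E UNIV)"
  proof -
    have "Infinite_Set_Sum.abs_summable_on (\<lambda>n. \<Prod>i\<in>{1..d}. (1 + real (n i)) powr (-p)) ({1..d} \<rightarrow>\<^sub>E UNIV)"
      by (rule abs_summable_on_prod_PiE) (use 1 in \<open>auto simp flip: abs_summable_equivalent\<close>)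
    thus ?thesis
      by (simp flip: abs_summable_equivalent add: abs_prod prod_nonneg)
  qed
  hence "(\<lambda>n. \<Prod>i\<in>{1..d}. (1 + real (n i)) powr (-p)) summable_on nonzero_tuples d"
    by (rule summable_on_subset_banach) (auto simp: nonzero_tuples_def)
  hence "(\<lambda>n. (b / 2) powr (-s) * (\<Prod>i\<in>{1..d}. (1 + real (n i)) powr (-p))) summable_on nonzero_tuples d"
    by (rule summable_on_cmult_right)
  thus ?thesis
  proof (rule summable_on_comparison_test)
    fix n assume n: "n \<in> nonzero_tuples d"
    define N where "N = (\<Sum>i=1..d. n i)"
    obtain j where j: "j \<in> {1..d}" "n j \<noteq> 0" using n by (auto simp: nonzero_tuples_def)
    have le: "n i \<le> N" if "i \<in> {1..d}" for i
      unfolding N_def using that by (intro member_le_sum) auto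
    have N1: "N \<ge> 1" using le[OF j(1)] j(2) by simp
    \<comment> \<open>The factor 1/2 pays for replacing N by 1 + N; this uses N \<ge> 1, i.e. the
      removal of the origin.\<close>
    have lower: "b / 2 * (1 + real N) \<le> (\<Sum>i=1..d. real (n i) * c i)"
    proof -
      have "b / 2 * (1 + real N) \<le> real N * b" using N1 b by (simp add: field_simps)
      also have "\<dots> = (\<Sum>i=1..d. real (n i) * b)" by (simp add: N_def sum_distrib_right)
      also have "\<dots> \<le> (\<Sum>i=1..d. real (n i) * c i)"
        by (intro sum_mono mult_left_mono b) auto
      finally show ?thesis .
    qed
    have s: "s > 0" using assms(2) by simp
    have "(\<Sum>i=1..d. real (n i) * c i) powr (-s) \<le> (b / 2 * (1 + real N)) powr (-s)"
      using lower b s by (intro powr_mono2') auto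
    also have "\<dots> = (b / 2) powr (-s) * (1 + real N) powr (-s)"
      by (rule powr_mult)
    also have "(1 + real N) powr (-s) = (\<Prod>i\<in>{1..d}. (1 + real N) powr (-p))"
      using False by (simp add: p_def powr_powr flip: powr_realpow)
    also have "\<dots> \<le> (\<Prod>i\<in>{1..d}. (1 + real (n i)) powr (-p))"
      using le p by (intro prod_mono conjI powr_mono2') auto
    finally show "(\<Sum>i=1..d. real (n i) * c i) powr (-s) \<le> (b / 2) powr (-s) * (\<Prod>i\<in>{1..d}. (1 + real (n i)) powr (-p))"
      by (simp add: mult_left_mono)
  qed simp
qed

text \<open>Weierstrass' theorem along the net of finite subsets: uniform convergence on small
  closed discs passes to derivatives. The differentiated series is recorded because the finite part
  is obtained by differentiating the remainder series term by term.\<close>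

lemma infsum_holomorphic:
  fixes f :: "'a \<Rightarrow> complex \<Rightarrow> complex"
  assumes "open A"
    and holo: "\<And>n. n \<in> I \<Longrightarrow> f n holomorphic_on A"
    and bnd: "\<And>z r. 0 < r \<Longrightarrow> cball z r \<subseteq> A \<Longrightarrow>
               \<exists>M. M summable_on I \<and> (\<forall>n\<in>I. \<forall>x\<in>cball z r. norm (f n x) \<le> M n)"
  shows "(\<lambda>x. \<Sum>\<^sub>\<infinity>n\<in>I. f n x) holomorphic_on A"
    and "\<And>z. z \<in> A \<Longrightarrow> ((\<lambda>n. deriv (f n) z) has_sum deriv (\<lambda>x. \<Sum>\<^sub>\<infinity>n\<in>I. f n x) z) I"
    and "\<And>z. z \<in> A \<Longrightarrow> (\<lambda>n. f n z) summable_on I"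
proof -
  define g where "g = (\<lambda>x. \<Sum>\<^sub>\<infinity>n\<in>I. f n x)"
  have main: "(\<lambda>n. f n z) summable_on I \<and> (\<exists>D. (g has_field_derivative D) (at z) \<and> ((\<lambda>n. deriv (f n) z) has_sum D) I)"
    if z: "z \<in> A" for z
  proof -
    obtain r where r: "r > 0" "cball z r \<subseteq> A"
      using \<open>open A\<close> z open_contains_cball by metis
    obtain M where M: "M summable_on I" "\<And>n x. n \<in> I \<Longrightarrow> x \<in> cball z r \<Longrightarrow> norm (f n x) \<le> M n"
      using bnd[OF r] by blast
    have "uniform_limit (cball z r) (\<lambda>X y. \<Sum>x\<in>X. f x y) g (finite_subsets_at_top I)"
      unfolding g_def by (rule Weierstrass_m_test_general[OF M(2,1)])
    moreover have "eventually (\<lambda>X. continuous_on (cball z r) (\<lambda>y. \<Sum>x\<in>X. f x y) \<and>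
      (\<forall>w \<in> ball z r. ((\<lambda>y. \<Sum>x\<in>X. f x y) has_field_derivative (\<Sum>x\<in>X. deriv (f x) w)) (at w))) (finite_subsets_at_top I)"
    proof (rule eventually_finite_subsets_at_top_weakI, intro conjI ballI)
      fix X assume X: "finite X" "X \<subseteq> I"
      show "continuous_on (cball z r) (\<lambda>y. \<Sum>x\<in>X. f x y)"
        using X r holo by (intro continuous_on_sum)
          (meson holomorphic_on_imp_continuous_on continuous_on_subset subsetD)
      fix w assume "w \<in> ball z r"
      hence "w \<in> A" using r by auto
      thus "((\<lambda>y. \<Sum>x\<in>X. f x y) has_field_derivative (\<Sum>x\<in>X. deriv (f x) w)) (at w)"
        using X holo \<open>open A\<close> by (intro DERIV_sum) (auto intro: holomorphic_derivI)
    qed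
    moreover have "\<not> trivial_limit (finite_subsets_at_top I)" by simp
    ultimately obtain g' where g': "\<And>w. w \<in> ball z r \<Longrightarrow> (g has_field_derivative (g' w)) (at w) \<and> ((\<lambda>X. \<Sum>x\<in>X. deriv (f x) w) \<longlongrightarrow> g' w) (finite_subsets_at_top I)"
      using r(1) by (elim has_complex_derivative_uniform_limit) blast+
    moreover have "(\<lambda>n. f n z) summable_on I"
    proof (rule abs_summable_summable, rule summable_on_comparison_test[OF M(1)])
      show "norm (f n z) \<le> M n" if "n \<in> I" for n
        using M(2)[OF that] r by simp
    qed simp
    ultimately show ?thesis using r(1)
      by (auto simp: has_sum_def intro!: exI[of _ "g' z"])
  qed
  have "g holomorphic_on A"
    unfolding holomorphic_on_open[OF \<open>open A\<close>] using main by blast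
  thus "(\<lambda>x. \<Sum>\<^sub>\<infinity>n\<in>I. f n x) holomorphic_on A" by (simp add: g_def)
  show "((\<lambda>n. deriv (f n) z) has_sum deriv (\<lambda>x. \<Sum>\<^sub>\<infinity>n\<in>I. f n x) z) I" if "z \<in> A" for z
    using main[OF that] DERIV_imp_deriv unfolding g_def by blast
  show "(\<lambda>n. f n z) summable_on I" if "z \<in> A" for z using main[OF that] by blast
qed

text \<open>After removal of singularities the difference vanishes on an open set, hence everywhere,
  so \<open>f\<close> and \<open>g\<close> agree on punctured neighbourhoods. Being nicely
  meromorphic then fixes the value at the centre, as the limit or as 0 at a pole.\<close>

lemma nicely_meromorphic_on_UNIV_eqI:
  assumes "f nicely_meromorphic_on UNIV" "g nicely_meromorphic_on UNIV"
    and "open U" "z0 \<in> U" "\<And>z. z \<in> U \<Longrightarrow> f z = g z"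
  shows "f = g"
proof -
  have mero: "f meromorphic_on UNIV" "g meromorphic_on UNIV"
    using assms by (auto simp: nicely_meromorphic_on_def)
  define h where "h = remove_sings (\<lambda>z. f z - g z)"
  have diff: "(\<lambda>z. f z - g z) meromorphic_on UNIV"
    by (intro meromorphic_intros mero)
  have h: "h nicely_meromorphic_on UNIV"
    unfolding h_def by (intro remove_sings_nicely_meromorphic diff)
  have "eventually (\<lambda>z. f z - g z = 0) (at z)" if "z \<in> U" for z
    using eventually_at_in_open'[OF \<open>open U\<close> that] by eventually_elim (use assms in auto)
  hence "h z = 0" if "z \<in> U" for z
    unfolding h_def using that by (intro remove_sings_eqI tendsto_eventually) auto
  hence "eventually (\<lambda>z. h z = 0) (at z0)"
    using eventually_at_in_open'[OF \<open>open U\<close> \<open>z0 \<in> U\<close>] by (auto elim: eventually_mono)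
  hence "frequently (\<lambda>z. h z = 0) (at z0)"
    by (intro eventually_frequently) auto
  hence h0: "h z = 0" for z
    by (rule frequently_eq_meromorphic_imp_constant[OF _ h open_UNIV connected_UNIV UNIV_I UNIV_I])
  show ?thesis
  proof
    fix z
    have "isolated_singularity_at (\<lambda>z. f z - g z) z"
      using diff by (auto simp: meromorphic_on_altdef)
    hence "eventually (\<lambda>w. h w = f w - g w) (at z)"
      unfolding h_def by (rule eventually_remove_sings_eq_at)
    hence ev: "eventually (\<lambda>w. f w = g w) (at z)"
      by eventually_elim (use h0 in auto)
    have "(is_pole f z \<and> f z = 0) \<or> f \<midarrow>z\<rightarrow> f z" "(is_pole g z \<and> g z = 0) \<or> g \<midarrow>z\<rightarrow> g z"
      using assms by (auto simp: nicely_meromorphic_on_def)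
    moreover have "is_pole f z = is_pole g z" by (rule is_pole_cong[OF ev refl])
    moreover have "f \<midarrow>z\<rightarrow> c \<longleftrightarrow> g \<midarrow>z\<rightarrow> c" for c by (rule tendsto_cong[OF ev])
    moreover have False if "is_pole g z" "g \<midarrow>z\<rightarrow> c" for c
      using that not_tendsto_and_filterlim_at_infinity[of "at z" g c] by (simp add: is_pole_def)
    ultimately have "f z = 0 \<and> g z = 0 \<or> g \<midarrow>z\<rightarrow> f z \<and> g \<midarrow>z\<rightarrow> g z"
      by simp blast
    thus "f z = g z"
      by (auto dest: LIM_unique)
  qed
qed

text \<open>Division by x - q shifts the Taylor series of \<open>f\<close> by one place, so the
  constant term is its linear coefficient. A simple pole and a removable singularity of
  \<open>g\<close> are treated alike.\<close>

lemma finite_part_div_linear: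
  assumes "f analytic_on {q}"
    and "eventually (\<lambda>x. g x = f x / (x - q)) (at q)"
  shows "finite_part g q = deriv f q"
proof -
  have "(\<lambda>w. f (q + w)) has_fps_expansion fps_expansion f q"
    using assms(1) by (rule analytic_at_imp_has_fps_expansion)
  hence "(\<lambda>w. f (q + w)) has_laurent_expansion fps_to_fls (fps_expansion f q)"
    by (rule has_laurent_expansion_fps)
  hence "(\<lambda>w. f (q + w) / w) has_laurent_expansion fps_to_fls (fps_expansion f q) / fls_X"
    by (intro laurent_expansion_intros)
  also have "fps_to_fls (fps_expansion f q) / fls_X = fls_shift 1 (fps_to_fls (fps_expansion f q))"
    by simp
  finally have "(\<lambda>w. f (q + w) / w) has_laurent_expansion fls_shift 1 (fps_to_fls (fps_expansion f q))" .
  moreover have "eventually (\<lambda>w. f (q + w) / w = g (q + w)) (at 0)"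
    using assms(2) by (simp add: at_to_0' eventually_filtermap add_ac eq_commute)
  ultimately have "(\<lambda>w. g (q + w)) has_laurent_expansion fls_shift 1 (fps_to_fls (fps_expansion f q))"
    by (subst has_laurent_expansion_cong) (auto simp: eq_commute elim: eventually_mono)
  hence "laurent_expansion g q = fls_shift 1 (fps_to_fls (fps_expansion f q))"
    by (rule laurent_expansion_eqI)
  thus ?thesis by (simp add: finite_part_def fps_expansion_def)
qed

section \<open>Bernoulli numbers and difference operators\<close>

text \<open>The symbol of the composed difference operator, with \<open>fps_X\<close> in the role of
  d/dy.\<close>

definition diff_fps :: "nat \<Rightarrow> (nat \<Rightarrow> complex) \<Rightarrow> complex fps" where
  "diff_fps d w = (\<Prod>i=1..d. fps_exp (w i) - 1)"

text \<open>The generating series of the u_m. Taking one \<open>fps_X\<close> out of each factor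
  first makes it the inverse of a unit when all w_i are nonzero.\<close>

definition recip_fps :: "nat \<Rightarrow> (nat \<Rightarrow> complex) \<Rightarrow> complex fps" where
  "recip_fps d w = inverse (\<Prod>i=1..d. fps_shift 1 (fps_exp (w i) - 1))"

lemma diff_fps_conv_shift:
  "diff_fps d w = fps_X ^ d * (\<Prod>i=1..d. fps_shift 1 (fps_exp (w i) - 1))"
proof -
  have "fps_exp c - 1 = fps_X * fps_shift 1 (fps_exp c - 1)" for c :: complex
    by (rule fps_ext) simp
  hence "diff_fps d w = (\<Prod>i=1..d. fps_X * fps_shift 1 (fps_exp (w i) - 1))"
    unfolding diff_fps_def by (intro prod.cong refl)
  thus ?thesis by (simp add: prod.distrib)
qed

lemma nth_0_prod_fps: "fps_nth (\<Prod>i\<in>A. f i) 0 = (\<Prod>i\<in>A. fps_nth (f i) 0)"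
  by (induction A rule: infinite_finite_induct) auto

lemma nth_0_shift_exp:
  fixes w :: "nat \<Rightarrow> complex"
  assumes "\<forall>i\<in>{1..d}. w i \<noteq> 0"
  shows "fps_nth (\<Prod>i=1..d. fps_shift 1 (fps_exp (w i) - 1)) 0 \<noteq> 0"
  using assms by (auto simp: nth_0_prod_fps)

lemma recip_fps_mult:
  assumes "\<forall>i\<in>{1..d}. w i \<noteq> 0"
  shows "recip_fps d w * diff_fps d w = fps_X ^ d"
  unfolding recip_fps_def diff_fps_conv_shift
  by (subst mult.left_commute, subst inverse_mult_eq_1[OF nth_0_shift_exp[OF assms]]) simp

lemma diff_fps_nth_less: "j < d \<Longrightarrow> fps_nth (diff_fps d w) j = 0"
  by (simp add: diff_fps_conv_shift fps_X_power_mult_nth)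

lemma fps_exp_sum: "fps_exp (\<Sum>i\<in>A. w i) = (\<Prod>i\<in>A. fps_exp (w i :: complex))"
  by (induction A rule: infinite_finite_induct) (auto simp: fps_exp_add_mult)

lemma diff_fps_conv_sum:
  "diff_fps d w = (\<Sum>S\<in>Pow {1..d}. (- 1) ^ (d - card S) * fps_exp (\<Sum>i\<in>S. w i))"
  unfolding diff_fps_def by (subst prod_diff_conv_sum') (simp_all add: fps_exp_sum)

lemma fps_nth_minus_one_power_mult: "fps_nth ((- 1) ^ k * f) n = (- 1) ^ k * fps_nth (f :: complex fps) n"
  by (cases "even k") auto

text \<open>The coefficient is \<open>G_op\<close> applied to x^n / n!, which links Taylor
  polynomials to the symbol.\<close>

lemma diff_fps_nth:
  "fps_nth (diff_fps d w) n = (\<Sum>S\<in>Pow {1..d}. (- 1) ^ (d - card S) * (\<Sum>i\<in>S. w i) ^ n / fact n)"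
  by (simp add: diff_fps_conv_sum fps_sum_nth fps_nth_minus_one_power_mult)

lemma G_op_altdef: "G_op d g v = (\<Sum>S\<in>Pow {1..d}. (- 1) ^ (d - card S) * g (\<Sum>i\<in>S. v i))"
proof -
  have "Pow {1..d} = insert {} {S. S \<subseteq> {1..d} \<and> S \<noteq> {}}" by auto
  thus ?thesis
    by (simp add: G_op_def F_op_def)
qed

lemma F_op_conv_G_op: "F_op d g v = G_op d g v - (- 1) ^ d * g 0"
  by (simp add: G_op_def)

text \<open>
  The difference operators multiply the exponential generating function of the powers by
  \<^term>\<open>diff_fps d w\<close>, which has order \<open>d\<close>.
\<close>
lemma G_op_power_eq_0:
  assumes "k < d"
  shows "G_op d (\<lambda>x. (y + x) ^ k) w = 0"
proof -
  have "fps_nth (fps_exp y * diff_fps d w) k = 0"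
    using assms by (auto simp: fps_mult_nth diff_fps_nth_less intro!: sum.neutral)
  also have "fps_exp y * diff_fps d w = (\<Sum>S\<in>Pow {1..d}. (- 1) ^ (d - card S) * fps_exp (y + (\<Sum>i\<in>S. w i)))"
    by (simp add: diff_fps_conv_sum sum_distrib_left fps_exp_add_mult mult_ac)
  also have "fps_nth \<dots> k = G_op d (\<lambda>x. (y + x) ^ k) w / fact k"
    by (simp add: G_op_altdef fps_sum_nth fps_nth_minus_one_power_mult sum_divide_distrib)
  finally show ?thesis by simp
qed

lemma G_op_cmult: "G_op d (\<lambda>x. c * g x) v = c * G_op d g v"
  by (simp add: G_op_altdef sum_distrib_left mult_ac)

lemma G_op_diff: "G_op d (\<lambda>x. f x - g x) v = G_op d f v - G_op d g v"
  by (simp add: G_op_altdef sum_subtractf algebra_simps)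

section \<open>Bernoullian polynomials and the coefficients of \<open>recip_fps\<close>\<close>

lemma bernoulli_gf_eq:
  assumes "\<forall>i\<in>{1..d}. w i \<noteq> 0"
  shows "bernoulli_gf d w a = fps_exp a * fps_const (\<Prod>i=1..d. w i) * recip_fps d w"
proof -
  have "bernoulli_gf d w a = (fps_X ^ d * (fps_exp a * fps_const (\<Prod>i=1..d. w i))) /
          (fps_X ^ d * (\<Prod>i=1..d. fps_shift 1 (fps_exp (w i) - 1)))"
    unfolding bernoulli_gf_def diff_fps_def [symmetric] diff_fps_conv_shift
    by (simp only: mult.assoc)
  also have "\<dots> = (fps_exp a * fps_const (\<Prod>i=1..d. w i)) / (\<Prod>i=1..d. fps_shift 1 (fps_exp (w i) - 1))"
    by (rule div_mult_mult1) simp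
  also have "\<dots> = fps_exp a * fps_const (\<Prod>i=1..d. w i) * recip_fps d w"
    unfolding recip_fps_def by (rule fps_divide_unit[OF nth_0_shift_exp[OF assms]])
  finally show ?thesis .
qed

lemma higher_bernoulli_eq:
  assumes "\<forall>i\<in>{1..d}. w i \<noteq> 0"
  shows "higher_bernoulli d w n a =
    fact n * (\<Prod>i=1..d. w i) * (\<Sum>k\<le>n. fps_nth (recip_fps d w) k * a ^ (n - k) / fact (n - k))"
proof -
  have "fps_nth (recip_fps d w * fps_exp a) n = (\<Sum>k\<le>n. fps_nth (recip_fps d w) k * a ^ (n - k) / fact (n - k))"
    by (simp add: fps_mult_nth atLeast0AtMost)
  moreover have "bernoulli_gf d w a = fps_const (\<Prod>i=1..d. w i) * (recip_fps d w * fps_exp a)"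
    unfolding bernoulli_gf_eq[OF assms] by (simp only: mult_ac)
  ultimately show ?thesis
    by (simp add: higher_bernoulli_def)
qed

lemma poly_eqI_pderiv:
  fixes p q :: "complex poly"
  assumes "poly p 0 = poly q 0" "\<And>a. poly (pderiv p) a = poly (pderiv q) a"
  shows "p = q"
proof -
  have "pderiv p = pderiv q" using assms(2) by (auto simp: poly_eq_poly_eq_iff [symmetric])
  hence "pderiv (p - q) = 0" by (simp add: pderiv_diff)
  hence "degree (p - q) = 0" by (simp add: pderiv_eq_0_iff)
  then obtain c where c: "p - q = [:c:]" by (elim degree_eq_zeroE)
  have "c = poly (p - q) 0" by (simp add: c)
  also have "\<dots> = 0" using assms(1) by simp
  finally show ?thesis using c by simp
qed

text \<open>Termwise integration of \<open>higher_bernoulli_eq\<close>, whose factorial and product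
  of the w_i cancel against the normalising constant. All exponents m + d - k are positive, so the
  result vanishes at 0; this value and the derivative determine the polynomial.\<close>

lemma bernoullian_poly_eq:
  assumes "\<forall>i\<in>{1..d}. w i \<noteq> 0" "d \<ge> 1"
  shows "bernoullian_poly d w m =
    (\<Sum>k\<le>m+d-1. monom (fact m * fps_nth (recip_fps d w) k / fact (m + d - k)) (m + d - k))"
    (is "_ = ?p")
proof -
  let ?P = "\<lambda>p. poly p 0 = 0 \<and> (\<forall>a. poly (pderiv p) a =
           fact m / (fact (m + d - 1) * (\<Prod>i=1..d. w i)) * higher_bernoulli d w (m + d - 1) a)"
  have W: "(\<Prod>i=1..d. w i) \<noteq> 0" using assms by auto
  have "poly (pderiv ?p) a = fact m * (\<Sum>k\<le>m+d-1. fps_nth (recip_fps d w) k * a ^ (m + d - 1 - k) / fact (m + d - 1 - k))" for a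
  proof -
    have "of_nat (m + d - k) * (fact m * fps_nth (recip_fps d w) k / fact (m + d - k)) * a ^ (m + d - k - 1) =
          fact m * (fps_nth (recip_fps d w) k * a ^ (m + d - 1 - k) / fact (m + d - 1 - k))" if "k \<le> m + d - 1" for k
    proof -
      have "m + d - k = Suc (m + d - 1 - k)" using that assms by simp
      moreover have "(fact (Suc r) :: complex) = of_nat (Suc r) * fact r" for r by simp
      ultimately show ?thesis
        by (simp del: fact_Suc of_nat_Suc)
    qed
    thus ?thesis
      by (simp add: higher_pderiv_sum[of 1, simplified] pderiv_monom poly_sum poly_monom sum_distrib_left)
  qed
  hence 1: "poly (pderiv ?p) a = fact m / (fact (m + d - 1) * (\<Prod>i=1..d. w i)) * higher_bernoulli d w (m + d - 1) a" for a
    using W by (simp add: higher_bernoulli_eq[OF assms(1)])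
  have 2: "poly ?p 0 = 0"
    unfolding poly_sum using assms(2) by (intro sum.neutral) (auto simp: poly_monom)
  show ?thesis
    unfolding bernoullian_poly_def
  proof (rule the_equality)
    show "?P ?p" using 1 2 by blast
    show "p = ?p" if "?P p" for p
      using that 1 2 by (intro poly_eqI_pderiv) simp_all
  qed
qed

lemma higher_deriv_poly: "(deriv ^^ n) (poly p) = poly ((pderiv ^^ n) (p :: complex poly))"
proof (induction n)
  case (Suc n)
  have "deriv (poly q) = poly (pderiv q)" for q :: "complex poly"
    by (rule ext, rule DERIV_imp_deriv, rule poly_DERIV)
  thus ?case using Suc by simp
qed simp

text \<open>The d-th derivative at 0 reads off the coefficient of degree d, to which only k = m
  contributes. This identifies the constants of the theorem as m! times the u_m of the
  expansion.\<close>

lemma higher_deriv_bernoullian: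
  assumes "\<forall>i\<in>{1..d}. w i \<noteq> 0" "d \<ge> 1"
  shows "(deriv ^^ d) (bernoullian d w m) 0 = fact m * fps_nth (recip_fps d w) m"
proof -
  have "bernoullian d w m = poly (bernoullian_poly d w m)"
    by (rule ext) (simp add: bernoullian_def)
  hence "(deriv ^^ d) (bernoullian d w m) 0 = coeff ((pderiv ^^ d) (bernoullian_poly d w m)) 0"
    by (simp add: higher_deriv_poly poly_0_coeff_0)
  also have "\<dots> = fact d * coeff (bernoullian_poly d w m) d"
    by (simp add: coeff_higher_pderiv pochhammer_fact)
  also have "coeff (bernoullian_poly d w m) d =
      (\<Sum>k\<le>m+d-1. if k = m then fact m * fps_nth (recip_fps d w) m / fact d else 0)"
    unfolding bernoullian_poly_eq[OF assms] coeff_sum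
    by (intro sum.cong refl) (use assms(2) in auto)
  also have "\<dots> = fact m * fps_nth (recip_fps d w) m / fact d"
    using assms(2) by simp
  finally show ?thesis by simp
qed

lemma sum_atMost_convolution:
  fixes u v :: "nat \<Rightarrow> complex"
  shows "(\<Sum>m\<le>n. \<Sum>j\<le>n-m. u m * v j * h (m + j)) = (\<Sum>p\<le>n. (\<Sum>m\<le>p. u m * v (p - m)) * h p)"
proof -
  have "(\<Sum>m\<le>n. \<Sum>j\<le>n-m. u m * v j * h (m + j)) = (\<Sum>(m,j)\<in>(SIGMA m:{..n}. {..n-m}). u m * v j * h (m + j))"
    by (rule sum.Sigma) auto
  also have "(SIGMA m:{..n}. {..n-m}) = {(m,j). m + j \<le> n}" by auto
  also have "(\<Sum>(m,j)\<in>{(m,j). m + j \<le> n}. u m * v j * h (m + j)) = (\<Sum>p\<le>n. \<Sum>m\<le>p. u m * v (p - m) * h (m + (p - m)))"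
    by (rule sum.triangle_reindex_eq)
  also have "\<dots> = (\<Sum>p\<le>n. (\<Sum>m\<le>p. u m * v (p - m)) * h p)"
    by (simp add: sum_distrib_right)
  finally show ?thesis .
qed

section \<open>Difference expansion of complex powers\<close>

locale barnes =
  fixes \<theta> :: real and lg :: "complex \<Rightarrow> complex" and d :: nat and w :: "nat \<Rightarrow> complex"
  assumes branch: "log_branch_on lg (half_plane \<theta>)"
    and d_pos: "d \<ge> 1"
    and w_half_plane: "i \<in> {1..d} \<Longrightarrow> w i \<in> half_plane \<theta>"
begin

definition rho :: "complex \<Rightarrow> real" where
  "rho z = Re (cis (- \<theta>) * z)"

abbreviation "H \<equiv> half_plane \<theta>"

abbreviation "shift S \<equiv> \<Sum>i\<in>S. w i"

lemma H_iff: "z \<in> H \<longleftrightarrow> 0 < rho z"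
  by (simp add: half_plane_iff rho_def)

lemma rho_add: "rho (x + y) = rho x + rho y"
  by (simp add: rho_def algebra_simps)

lemma rho_sum: "rho (\<Sum>i\<in>A. f i) = (\<Sum>i\<in>A. rho (f i))"
  unfolding rho_def sum_distrib_left Re_sum ..

lemma rho_of_nat_mult: "rho (of_nat n * x) = real n * rho x"
  unfolding rho_def by (simp add: algebra_simps)

lemma rho_le_norm: "rho z \<le> norm z"
  unfolding rho_def by (rule order_trans[OF complex_Re_le_cmod]) (simp add: norm_mult)

lemma w_neq_0: "\<forall>i\<in>{1..d}. w i \<noteq> 0"
  using w_half_plane by (auto simp: half_plane_def)

lemma rho_w: "i \<in> {1..d} \<Longrightarrow> rho (w i) > 0"
  using w_half_plane H_iff by blast

lemma rho_shift_nonneg: "S \<subseteq> {1..d} \<Longrightarrow> rho (shift S) \<ge> 0"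
  unfolding rho_sum by (intro sum_nonneg less_imp_le rho_w) auto

lemma shift_in_H: "S \<subseteq> {1..d} \<Longrightarrow> S \<noteq> {} \<Longrightarrow> shift S \<in> H"
  unfolding H_iff rho_sum by (intro sum_pos rho_w) (auto intro: finite_subset)

lemma add_shift_in_H: "y \<in> H \<Longrightarrow> S \<subseteq> {1..d} \<Longrightarrow> y + shift S \<in> H"
  using rho_shift_nonneg[of S] by (simp add: H_iff rho_add)

lemma rho_dotp: "rho (dotp d n w) = (\<Sum>i=1..d. real (n i) * rho (w i))"
  by (simp add: dotp_def rho_sum rho_of_nat_mult)

lemma dotp_in_H:
  assumes "n \<in> nonzero_tuples d"
  shows "dotp d n w \<in> H"
proof -
  obtain j where "j \<in> {1..d}" "n j \<noteq> 0" using assms by (auto simp: nonzero_tuples_def)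
  thus ?thesis
    unfolding H_iff rho_dotp
    by (intro sum_pos2[of _ j] mult_pos_pos rho_w mult_nonneg_nonneg less_imp_le[OF rho_w]) auto
qed

lemma summable_rho_powr: "s > real d \<Longrightarrow> (\<lambda>n. rho (dotp d n w) powr (- s)) summable_on nonzero_tuples d"
  unfolding rho_dotp by (rule summable_on_inverse_power_sum[OF rho_w])

lemma H_eq: "H = {z. cis \<theta> \<bullet> z > 0}"
  by (auto simp: H_iff rho_def inner_complex_def)

lemma open_H: "open H"
  unfolding H_eq by (rule open_halfspace_gt)

lemma convex_H: "convex H"
  unfolding H_eq by (rule convex_halfspace_gt)

lemma convex_rho_ge: "convex {z. rho z \<ge> r}"
proof -
  have "{z. rho z \<ge> r} = {z. cis \<theta> \<bullet> z \<ge> r}"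
    by (auto simp: rho_def inner_complex_def)
  thus ?thesis by (simp add: convex_halfspace_ge)
qed

section \<open>The branch of the logarithm and the size of complex powers\<close>

lemma exp_lg: "z \<in> H \<Longrightarrow> exp (lg z) = z"
  using branch by (auto simp: log_branch_on_def)

lemma neq_0_H: "z \<in> H \<Longrightarrow> z \<noteq> 0"
  by (auto simp: half_plane_def)

lemma lg_deriv:
  assumes "z \<in> H"
  shows "(lg has_field_derivative 1 / z) (at z)"
proof -
  have D: "(lg has_field_derivative deriv lg z) (at z)"
    using branch assms open_H by (auto simp: log_branch_on_def intro: holomorphic_derivI)
  have "((\<lambda>x. exp (lg x)) has_field_derivative exp (lg z) * deriv lg z) (at z)"
    by (rule DERIV_chain2[OF DERIV_exp D])
  moreover have "((\<lambda>x. exp (lg x)) has_field_derivative 1) (at z)"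
    by (rule has_field_derivative_transform_within_open[OF DERIV_ident open_H assms])
       (simp add: exp_lg)
  ultimately have "z * deriv lg z = 1"
    using DERIV_unique assms exp_lg by metis
  hence "deriv lg z = 1 / z" using neq_0_H[OF assms] by (simp add: field_simps)
  thus ?thesis using D by simp
qed

text \<open>On the convex set \<open>H\<close> the branch differs by a constant from the principal
  \<open>Ln\<close> of the rotated argument, whose imaginary part is at most pi in size. The bound
  controls the factor exp (Im \<alpha> * Im (lg y)) in the modulus of a complex power.\<close>

lemma Im_lg_bounded: "\<exists>B. \<forall>z\<in>H. \<bar>Im (lg z)\<bar> \<le> B"
proof -
  have "((\<lambda>z. lg z - Ln (cis (- \<theta>) * z)) has_field_derivative 0) (at z within H)" if "z \<in> H" for z
  proof -
    have "cis (- \<theta>) * z \<notin> \<real>\<^sub>\<le>\<^sub>0"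
      using that by (auto simp: H_iff rho_def complex_nonpos_Reals_iff)
    define k where "k = cis (- \<theta>)"
    have k: "k \<noteq> 0" by (simp add: k_def)
    have "((\<lambda>z. Ln (k * z)) has_field_derivative inverse (k * z) * (k * 1)) (at z)"
      by (rule DERIV_chain2[OF has_field_derivative_Ln DERIV_cmult[OF DERIV_ident]])
         (use \<open>cis (- \<theta>) * z \<notin> _\<close> in \<open>simp add: k_def\<close>)
    from DERIV_diff[OF lg_deriv[OF that] this]
    have "((\<lambda>z. lg z - Ln (k * z)) has_field_derivative 0) (at z)"
      using neq_0_H[OF that] k by (simp add: field_simps)
    thus ?thesis by (simp add: has_field_derivative_at_within k_def)
  qed
  from has_field_derivative_zero_constant[OF convex_H this]
  obtain c where c: "lg z - Ln (cis (- \<theta>) * z) = c" if "z \<in> H" for z by blast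
  have "\<bar>Im (lg z)\<bar> \<le> \<bar>Im c\<bar> + pi" if "z \<in> H" for z
  proof -
    have "\<bar>Im (Ln v)\<bar> \<le> pi" if "v \<noteq> 0" for v
      using mpi_less_Im_Ln[OF that] Im_Ln_le_pi[OF that] by linarith
    moreover have "cis (- \<theta>) * z \<noteq> 0" using neq_0_H[OF that] by simp
    ultimately have "\<bar>Im (Ln (cis (- \<theta>) * z))\<bar> \<le> pi" .
    moreover have "Im (lg z) = Im c + Im (Ln (cis (- \<theta>) * z))"
      using arg_cong[OF c[OF that], of Im] by simp
    ultimately show ?thesis by linarith
  qed
  thus ?thesis by blast
qed

lemma Re_lg: "z \<in> H \<Longrightarrow> Re (lg z) = ln (norm z)"
  using exp_lg[of z] by (metis norm_exp_eq_Re ln_exp)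

text \<open>
  Up to the factor \<open>\<Prod>j=1..d. j - \<alpha>\<close>, the function \<open>hp m \<alpha>\<close> is the \<open>m\<close>-th derivative of a
  \<open>d\<close>-fold primitive of \<open>y powr (- \<alpha>)\<close>; the factor removes the poles in \<open>\<alpha>\<close> of the primitives.
\<close>
definition hp :: "nat \<Rightarrow> complex \<Rightarrow> complex \<Rightarrow> complex" where
  "hp m \<alpha> y = (\<Prod>j<m. of_nat d - of_nat j - \<alpha>) * exp ((of_nat d - of_nat m - \<alpha>) * lg y)"

lemma exp_diff_one_lg: "y \<in> H \<Longrightarrow> exp ((c - 1) * lg y) = exp (c * lg y) / y"
  by (simp add: ring_distribs exp_diff exp_lg)

lemma hp_deriv:
  assumes "y \<in> H"
  shows "(hp m \<alpha> has_field_derivative hp (Suc m) \<alpha> y) (at y)"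
proof -
  define c where "c = of_nat d - of_nat m - \<alpha>"
  define P where "P = (\<Prod>j<m. of_nat d - of_nat j - \<alpha>)"
  have 1: "((\<lambda>y. P * exp (c * lg y)) has_field_derivative P * (exp (c * lg y) * (c * (1 / y)))) (at y)"
    by (intro DERIV_cmult DERIV_chain2[OF DERIV_exp] lg_deriv assms)
  have "P * (exp (c * lg y) * (c * (1 / y))) = (P * c) * exp ((c - 1) * lg y)"
    by (simp add: exp_diff_one_lg[OF assms])
  also have "\<dots> = hp (Suc m) \<alpha> y"
    by (simp add: hp_def P_def c_def algebra_simps)
  finally have 2: "P * (exp (c * lg y) * (c * (1 / y))) = hp (Suc m) \<alpha> y" .
  have "hp m \<alpha> = (\<lambda>y. P * exp (c * lg y))"
    by (rule ext) (simp add: hp_def P_def c_def)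
  thus ?thesis using 1 by (simp only: 2)
qed

lemma hp_holomorphic: "(\<lambda>\<alpha>. hp m \<alpha> y) holomorphic_on A"
  unfolding hp_def by (intro holomorphic_intros)

text \<open>The condition on Re \<alpha> makes the exponent nonpositive, so
  \<open>rho_le_norm\<close> yields an upper bound for the power of norm y. Continuity of \<Psi>
  later gives bounds uniform on compact sets of \<alpha>.\<close>

lemma norm_hp_le:
  "\<exists>\<Psi>. continuous_on UNIV \<Psi> \<and> (\<forall>\<alpha> y. y \<in> H \<longrightarrow> real d - real m \<le> Re \<alpha> \<longrightarrow>
     norm (hp m \<alpha> y) \<le> \<Psi> \<alpha> * rho y powr (real d - real m - Re \<alpha>))"
proof -
  obtain B where B: "\<And>z. z \<in> H \<Longrightarrow> \<bar>Im (lg z)\<bar> \<le> B" using Im_lg_bounded by blast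
  define \<Psi> :: "complex \<Rightarrow> real" where "\<Psi> = (\<lambda>\<alpha>. norm (\<Prod>j<m. of_nat d - of_nat j - \<alpha>) * exp (\<bar>Im \<alpha>\<bar> * B))"
  have "norm (hp m \<alpha> y) \<le> \<Psi> \<alpha> * rho y powr (real d - real m - Re \<alpha>)"
    if y: "y \<in> H" and le: "real d - real m \<le> Re \<alpha>" for \<alpha> y
  proof -
    define c where "c = of_nat d - of_nat m - \<alpha>"
    have c: "Re c = real d - real m - Re \<alpha>" "Im c = - Im \<alpha>" by (simp_all add: c_def)
    have "norm (exp (c * lg y)) = exp (Re c * ln (norm y)) * exp (Im \<alpha> * Im (lg y))"
      using Re_lg[OF y] c by (simp add: exp_add[symmetric])
    also have "exp (Re c * ln (norm y)) = norm y powr Re c"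
      using neq_0_H[OF y] by (simp add: powr_def)
    also have "norm y powr Re c * exp (Im \<alpha> * Im (lg y)) \<le> rho y powr Re c * exp (\<bar>Im \<alpha>\<bar> * B)"
    proof (rule mult_mono)
      show "norm y powr Re c \<le> rho y powr Re c"
        using y rho_le_norm[of y] c le by (intro powr_mono2') (auto simp: H_iff)
      have "Im \<alpha> * Im (lg y) \<le> \<bar>Im \<alpha>\<bar> * B"
        using B[OF y] by (metis abs_ge_self abs_ge_zero abs_mult mult_left_mono order_trans)
      thus "exp (Im \<alpha> * Im (lg y)) \<le> exp (\<bar>Im \<alpha>\<bar> * B)" by simp
    qed simp_all
    finally have "norm (exp (c * lg y)) \<le> rho y powr Re c * exp (\<bar>Im \<alpha>\<bar> * B)" .
    from mult_left_mono[OF this norm_ge_zero[of "\<Prod>j<m. of_nat d - of_nat j - \<alpha>"]]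
    show ?thesis
      unfolding hp_def c_def[symmetric] \<Psi>_def norm_mult c(1)[symmetric] by (simp only: mult_ac)
  qed
  moreover have "continuous_on UNIV \<Psi>"
    unfolding \<Psi>_def by (intro continuous_intros)
  ultimately show ?thesis by blast
qed

text \<open>\<open>hp d\<close> is the cleared power y^(-\<alpha>), and the subtracted sum is the
  composed difference of the cleared P(y); what is left is one term of the remainder series.\<close>

definition tail :: "nat \<Rightarrow> complex \<Rightarrow> complex \<Rightarrow> complex" where
  "tail K \<alpha> y = hp d \<alpha> y - (\<Sum>m\<le>K. fps_nth (recip_fps d w) m * G_op d (\<lambda>x. hp m \<alpha> (y + x)) w)"

text \<open>
  Expanding around \<open>y\<close> up to derivatives of total order \<open>d + K\<close> leaves exactly \<open>hp d \<alpha> y\<close>, because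
  the coefficients convolve to \<^term>\<open>recip_fps d w * diff_fps d w = fps_X ^ d\<close>.
\<close>
lemma Taylor_main_term:
  "(\<Sum>m\<le>K. fps_nth (recip_fps d w) m *
      G_op d (\<lambda>x. \<Sum>j\<le>d+K-m. hp (m + j) \<alpha> y * x ^ j / fact j) w) = hp d \<alpha> y"
proof -
  let ?u = "fps_nth (recip_fps d w)" and ?v = "fps_nth (diff_fps d w)"
  have G: "G_op d (\<lambda>x. \<Sum>j\<le>N. hp (m + j) \<alpha> y * x ^ j / fact j) w = (\<Sum>j\<le>N. ?v j * hp (m + j) \<alpha> y)" for N m
    unfolding G_op_altdef diff_fps_nth sum_distrib_left sum_distrib_right
    by (subst sum.swap) (simp add: field_simps)
  have "(\<Sum>m\<le>K. ?u m * G_op d (\<lambda>x. \<Sum>j\<le>d+K-m. hp (m + j) \<alpha> y * x ^ j / fact j) w) =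
        (\<Sum>m\<le>K. \<Sum>j\<le>d+K-m. ?u m * ?v j * hp (m + j) \<alpha> y)"
    unfolding G by (simp add: sum_distrib_left mult.assoc)
  \<comment> \<open>The added m = K+1..d+K contribute nothing: there j \<le> d+K-m < d, and
    \<open>diff_fps\<close> has no coefficients below degree d.\<close>
  also have "\<dots> = (\<Sum>m\<le>d+K. \<Sum>j\<le>d+K-m. ?u m * ?v j * hp (m + j) \<alpha> y)"
    by (intro sum.mono_neutral_left ballI sum.neutral) (auto simp: diff_fps_nth_less)
  also have "\<dots> = (\<Sum>p\<le>d+K. (\<Sum>m\<le>p. ?u m * ?v (p - m)) * hp p \<alpha> y)"
    by (rule sum_atMost_convolution)
  also have "\<dots> = (\<Sum>p\<le>d+K. fps_nth (fps_X ^ d) p * hp p \<alpha> y)"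
    by (simp add: recip_fps_mult[OF w_neq_0, symmetric] fps_mult_nth atLeast0AtMost)
  also have "\<dots> = (\<Sum>p\<le>d+K. if p = d then hp d \<alpha> y else 0)"
    by (intro sum.cong refl) auto
  also have "\<dots> = hp d \<alpha> y" by simp
  finally show ?thesis .
qed

text \<open>The expansion of \<open>hp m\<close> at y is cut at order d + K - m, so for every m the
  remainder is governed by the same derivative \<open>hp (Suc (d + K))\<close>. On the convex set
  rho x \<ge> rho y, which contains all points y + shift S, the bound for it is largest at
  y.\<close>

lemma norm_tail_le:
  "\<exists>\<Psi>. continuous_on UNIV \<Psi> \<and> (\<forall>\<alpha> y. y \<in> H \<longrightarrow> - real (Suc K) \<le> Re \<alpha> \<longrightarrow>
     norm (tail K \<alpha> y) \<le> \<Psi> \<alpha> * rho y powr (- real (Suc K) - Re \<alpha>))"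
proof -
  let ?u = "fps_nth (recip_fps d w)"
  obtain \<Psi> where \<Psi>: "continuous_on UNIV \<Psi>"
    "\<And>\<alpha> y. y \<in> H \<Longrightarrow> - real (Suc K) \<le> Re \<alpha> \<Longrightarrow>
       norm (hp (Suc (d + K)) \<alpha> y) \<le> \<Psi> \<alpha> * rho y powr (- real (Suc K) - Re \<alpha>)"
    using norm_hp_le[of "Suc (d + K)"] by auto
  define C where "C = (\<Sum>m\<le>K. norm (?u m) * (\<Sum>S\<in>Pow {1..d}. norm (shift S) ^ Suc (d + K - m) / fact (d + K - m)))"
  have "norm (tail K \<alpha> y) \<le> (C * \<Psi> \<alpha>) * rho y powr (- real (Suc K) - Re \<alpha>)"
    if y: "y \<in> H" and le: "- real (Suc K) \<le> Re \<alpha>" for \<alpha> y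
  proof -
    define B where "B = \<Psi> \<alpha> * rho y powr (- real (Suc K) - Re \<alpha>)"
    define R where "R = (\<lambda>m x. hp m \<alpha> (y + x) - (\<Sum>j\<le>d+K-m. hp (m + j) \<alpha> y * x ^ j / fact j))"
    have yH: "x \<in> H" if "rho y \<le> rho x" for x
      using that y by (auto simp: H_iff)
    \<comment> \<open>The sign is read off the bound itself, which dominates a norm and has a
      positive power as its other factor.\<close>
    have \<Psi>0: "\<Psi> \<alpha> \<ge> 0"
    proof -
      have "0 \<le> \<Psi> \<alpha> * rho y powr (- real (Suc K) - Re \<alpha>)"
        using \<Psi>(2)[OF y le] norm_ge_zero order_trans by blast
      moreover have "rho y powr (- real (Suc K) - Re \<alpha>) > 0"
        using y by (simp add: H_iff)
      ultimately show ?thesis by (simp add: zero_le_mult_iff)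
    qed
    have R: "norm (R m (shift S)) \<le> B * (norm (shift S) ^ Suc (d + K - m) / fact (d + K - m))"
      if "m \<le> K" "S \<subseteq> {1..d}" for m S
    proof -
      have "norm (hp (m + 0) \<alpha> (y + shift S) - (\<Sum>j\<le>d+K-m. hp (m + j) \<alpha> y * ((y + shift S) - y) ^ j / fact j))
              \<le> B * norm ((y + shift S) - y) ^ Suc (d + K - m) / fact (d + K - m)"
      proof (rule complex_Taylor[where S = "{z. rho z \<ge> rho y}" and f = "\<lambda>j. hp (m + j) \<alpha>"])
        show "(hp (m + i) \<alpha> has_field_derivative hp (m + Suc i) \<alpha> x) (at x within {z. rho y \<le> rho z})"
          if "x \<in> {z. rho y \<le> rho z}" for i x
          using that hp_deriv[of x "m + i" \<alpha>] yH by (auto intro: has_field_derivative_at_within)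
        show "norm (hp (m + Suc (d + K - m)) \<alpha> x) \<le> B" if "x \<in> {z. rho y \<le> rho z}" for x
        proof -
          have "m + Suc (d + K - m) = Suc (d + K)" using \<open>m \<le> K\<close> by simp
          hence "norm (hp (m + Suc (d + K - m)) \<alpha> x) \<le> \<Psi> \<alpha> * rho x powr (- real (Suc K) - Re \<alpha>)"
            using \<Psi>(2)[of x \<alpha>] yH[of x] that le by simp
          also have "\<dots> \<le> B"
            unfolding B_def using that y le
            by (intro mult_left_mono powr_mono2' \<Psi>0) (auto simp: H_iff)
          finally show ?thesis .
        qed
        show "y + shift S \<in> {z. rho y \<le> rho z}"
          using rho_shift_nonneg[OF \<open>S \<subseteq> {1..d}\<close>] by (simp add: rho_add)
      qed (auto simp: convex_rho_ge)
      thus ?thesis by (simp add: R_def)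
    qed
    have "tail K \<alpha> y = - (\<Sum>m\<le>K. ?u m * G_op d (R m) w)"
      unfolding R_def G_op_diff right_diff_distrib sum_subtractf Taylor_main_term by (simp add: tail_def)
    also have "norm \<dots> \<le> (\<Sum>m\<le>K. norm (?u m) * (\<Sum>S\<in>Pow {1..d}. norm (R m (shift S))))"
      unfolding norm_minus_cancel G_op_altdef
      by (intro sum_norm_le) (auto simp: norm_mult norm_power intro!: mult_left_mono sum_norm_le)
    also have "\<dots> \<le> (\<Sum>m\<le>K. norm (?u m) * (\<Sum>S\<in>Pow {1..d}. B * (norm (shift S) ^ Suc (d + K - m) / fact (d + K - m))))"
      by (intro sum_mono mult_left_mono R) auto
    also have "\<dots> = C * B"
      by (simp only: C_def sum_distrib_left sum_distrib_right mult_ac)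
    finally show ?thesis by (simp add: B_def mult_ac)
  qed
  moreover have "continuous_on UNIV (\<lambda>\<alpha>. C * \<Psi> \<alpha>)"
    by (intro continuous_intros \<Psi>(1))
  ultimately show ?thesis by blast
qed

end

section \<open>Meromorphic continuation\<close>

lemma has_sum_finite_sum:
  fixes f :: "'b \<Rightarrow> 'a \<Rightarrow> 'c :: topological_comm_monoid_add"
  assumes "finite I" "\<And>i. i \<in> I \<Longrightarrow> (f i has_sum s i) A"
  shows "((\<lambda>x. \<Sum>i\<in>I. f i x) has_sum (\<Sum>i\<in>I. s i)) A"
  using assms by (induction I rule: finite_induct) (auto intro: has_sum_add)

lemma has_sum_diff:
  fixes f g :: "'a \<Rightarrow> 'b :: real_normed_vector"
  assumes "(f has_sum a) A" "(g has_sum b) A"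
  shows "((\<lambda>x. f x - g x) has_sum (a - b)) A"
  using has_sum_add[OF assms(1), of "\<lambda>x. - g x" "- b"] assms(2) by (simp add: has_sum_uminus)

text \<open>The logarithmic derivative of the product at 0 is \<Sum>1/i; this is the source of the
  harmonic numbers.\<close>

lemma has_field_derivative_prod_of_nat_add:
  "((\<lambda>x. \<Prod>i=1..k. of_nat i + x) has_field_derivative (fact k * harm k :: complex)) (at 0)"
proof (induction k)
  case (Suc k)
  have "((\<lambda>x. (\<Prod>i=1..k. of_nat i + x) * (of_nat (Suc k) + x)) has_field_derivative
          (\<Prod>i=1..k. of_nat i + 0) * 1 + fact k * harm k * (of_nat (Suc k) + 0)) (at (0::complex))"
    by (rule DERIV_mult'[OF Suc]) (auto intro!: derivative_eq_intros)
  also have "(\<Prod>i=1..k. of_nat i + 0) = (fact k :: complex)"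
    by (simp add: fact_prod)
  also have "fact k * 1 + fact k * harm k * (of_nat (Suc k) + 0) = (fact (Suc k) * harm (Suc k) :: complex)"
    by (simp add: harm_Suc field_simps del: of_nat_Suc)
  finally show ?case by simp
qed (simp add: harm_def)

context barnes
begin

text \<open>
  Shifting \<open>n\<close> by the indicator of \<open>S\<close> maps the lattice onto the points with \<open>n i \<noteq> 0\<close> on \<open>S\<close>, so
  by inclusion-exclusion only the value at the origin survives; it is the term missing on the left.
\<close>
lemma has_sum_G_op:
  assumes "(\<lambda>n. g (dotp d n w)) summable_on nonzero_tuples d"
  shows "((\<lambda>n. G_op d (\<lambda>x. g (dotp d n w + x)) w) has_sum (- F_op d g w)) (nonzero_tuples d)"
proof -
  define T :: "(nat \<Rightarrow> nat) set" where "T = {1..d} \<rightarrow>\<^sub>E UNIV"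
  define z :: "nat \<Rightarrow> nat" where "z = (\<lambda>i\<in>{1..d}. 0)"
  have T: "T = insert z (nonzero_tuples d)"
  proof (intro equalityI subsetI)
    fix n assume n: "n \<in> T"
    have "n = z" if "\<forall>i\<in>{1..d}. n i = 0"
      using n that by (intro PiE_ext[of n "{1..d}" "\<lambda>_. UNIV" z]) (auto simp: T_def z_def)
    thus "n \<in> insert z (nonzero_tuples d)"
      using n by (auto simp: nonzero_tuples_def T_def)
  qed (auto simp: T_def z_def nonzero_tuples_def)
  have z_notin: "z \<notin> nonzero_tuples d" by (auto simp: z_def nonzero_tuples_def)
  \<comment> \<open>Extension by 0 to the origin gives a summable function on the full lattice
    \<open>T\<close>, which the shifts by indicators map into itself.\<close>
  define g0 where "g0 = (\<lambda>n. if n \<in> nonzero_tuples d then g (dotp d n w) else 0)"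
  define incr where "incr = (\<lambda>S (n :: nat \<Rightarrow> nat) i. if i \<in> S then Suc (n i) else n i)"
  define decr where "decr = (\<lambda>S (n :: nat \<Rightarrow> nat) i. if i \<in> S then n i - 1 else n i)"
  define b :: "nat set \<Rightarrow> (nat \<Rightarrow> nat) \<Rightarrow> complex" where "b = (\<lambda>S n. \<Prod>i\<in>S. of_bool (n i \<noteq> 0))"
  define TS where "TS = (\<lambda>S. {n \<in> T. \<forall>i\<in>S. n i \<noteq> 0})"
  have sum0: "g0 summable_on T"
    by (rule iffD1[OF summable_on_cong_neutral assms]) (auto simp: g0_def T)
  \<comment> \<open>The sum over the points nonzero on S is expressed in two ways: by the cut-off
    \<open>b S\<close> on \<open>T\<close>, and by shifting \<open>T\<close> with
    \<open>incr S\<close>.\<close>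
  define X where "X = (\<lambda>S. infsum g0 (TS S))"
  have X: "(g0 has_sum X S) (TS S)" for S
    unfolding X_def by (intro has_sum_infsum summable_on_subset_banach[OF sum0]) (auto simp: TS_def)
  have b_X: "((\<lambda>n. b S n * g0 n) has_sum X S) T" if "S \<subseteq> {1..d}" for S
  proof -
    have fin: "finite S" using that finite_subset by blast
    have "b S n = 0" if "n \<in> T - TS S" for n
      using that fin by (auto simp: b_def TS_def)
    moreover have "b S n = 1" if "n \<in> TS S" for n
      using that by (auto simp: b_def TS_def)
    ultimately show ?thesis
      by (intro iffD1[OF has_sum_cong_neutral X[of S]]) (auto simp: TS_def)
  qed
  have incr_X: "((\<lambda>n. g0 (incr S n)) has_sum X S) T" if S: "S \<subseteq> {1..d}" for S
  proof -
    have "((\<lambda>n. g0 (incr S n)) has_sum X S) T = (g0 has_sum X S) (TS S)"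
    proof (rule has_sum_reindex_bij_witness[where i = "decr S" and j = "incr S"])
      show "decr S (incr S n) = n" for n
        by (auto simp: decr_def incr_def)
      show "incr S n \<in> TS S" if "n \<in> T" for n
        using that S by (auto simp: TS_def T_def incr_def PiE_iff extensional_def)
      show "incr S (decr S n) = n" if "n \<in> TS S" for n
        using that by (auto simp: decr_def incr_def TS_def)
      show "decr S n \<in> T" if "n \<in> TS S" for n
        using that S by (auto simp: TS_def T_def decr_def PiE_iff extensional_def)
    qed simp_all
    thus ?thesis using X by simp
  qed
  define G where "G = (\<lambda>n. \<Sum>S\<in>Pow {1..d}. (- 1) ^ (d - card S) * g0 (incr S n))"
  have "((\<lambda>n. \<Sum>S\<in>Pow {1..d}. (- 1) ^ (d - card S) * (b S n * g0 n)) has_sum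
          (\<Sum>S\<in>Pow {1..d}. (- 1) ^ (d - card S) * X S)) T"
    by (intro has_sum_finite_sum has_sum_cmult_right b_X) auto
  \<comment> \<open>The signed sum of the cut-offs is \<Prod>(of_bool (n i \<noteq> 0) - 1), which
    has a zero factor once some n i is nonzero; at the origin \<open>g0\<close> itself is 0.\<close>
  moreover have "(\<Sum>S\<in>Pow {1..d}. (- 1) ^ (d - card S) * (b S n * g0 n)) = 0" if "n \<in> T" for n
  proof (cases "n = z")
    case True
    thus ?thesis using z_notin by (simp add: g0_def)
  next
    case False
    hence "n \<in> nonzero_tuples d" using that unfolding T by blast
    then obtain j where j: "j \<in> {1..d}" "n j \<noteq> 0" unfolding nonzero_tuples_def by blast
    have "(\<Prod>i=1..d. of_bool (n i \<noteq> 0) - 1) = (\<Sum>S\<in>Pow {1..d}. (- 1) ^ (d - card S) * b S n)"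
      by (subst prod_diff_conv_sum') (simp_all add: b_def)
    moreover have "(\<Prod>i=1..d. of_bool (n i \<noteq> 0) - 1) = (0 :: complex)"
      using j by (intro prod_zero) auto
    ultimately show ?thesis
      by (simp add: sum_distrib_right [symmetric] mult.assoc [symmetric])
  qed
  ultimately have "((\<lambda>_. 0) has_sum (\<Sum>S\<in>Pow {1..d}. (- 1) ^ (d - card S) * X S)) T"
    by (subst (asm) has_sum_cong[where g = "\<lambda>_. 0"]) auto
  hence X0: "(\<Sum>S\<in>Pow {1..d}. (- 1) ^ (d - card S) * X S) = 0"
    by (rule has_sum_unique[OF _ has_sum_0_simp])
  have "(G has_sum (\<Sum>S\<in>Pow {1..d}. (- 1) ^ (d - card S) * X S)) T"
    unfolding G_def by (intro has_sum_finite_sum has_sum_cmult_right incr_X) auto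
  hence G0: "(G has_sum 0) T" by (simp only: X0)
  have dotp_incr: "dotp d (incr S n) w = dotp d n w + shift S" if "S \<subseteq> {1..d}" for S n
  proof -
    have "dotp d (incr S n) w = (\<Sum>i=1..d. of_nat (n i) * w i + (if i \<in> S then w i else 0))"
      unfolding dotp_def by (intro sum.cong refl) (auto simp: incr_def algebra_simps)
    also have "\<dots> = dotp d n w + (\<Sum>i\<in>{1..d}. if i \<in> S then w i else 0)"
      by (simp add: sum.distrib dotp_def)
    also have "(\<Sum>i\<in>{1..d}. if i \<in> S then w i else 0) = shift S"
      using that by (simp add: sum.inter_restrict [symmetric] Int_absorb1)
    finally show ?thesis .
  qed
  have incr_nonzero: "incr S n \<in> nonzero_tuples d" if "n \<in> nonzero_tuples d" "S \<subseteq> {1..d}" for n S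
    using that by (auto simp: nonzero_tuples_def incr_def PiE_iff extensional_def)
  have G_nonzero: "G n = G_op d (\<lambda>x. g (dotp d n w + x)) w" if "n \<in> nonzero_tuples d" for n
    unfolding G_def G_op_altdef
    by (intro sum.cong refl) (simp add: g0_def incr_nonzero[OF that] dotp_incr)
  \<comment> \<open>The empty S contributes \<open>g0\<close> at the origin, which is 0; so the full
    alternating sum reduces to \<open>F_op\<close>.\<close>
  have G_z: "G z = F_op d g w"
  proof -
    have "G z = (\<Sum>S\<in>{S. S \<subseteq> {1..d} \<and> S \<noteq> {}}. (- 1) ^ (d - card S) * g0 (incr S z))"
    proof -
      have "incr {} z = z" by (simp add: incr_def)
      hence "g0 (incr {} z) = 0" using z_notin by (simp add: g0_def)
      thus ?thesis
        unfolding G_def by (intro sum.mono_neutral_right) auto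
    qed
    also have "\<dots> = F_op d g w"
      unfolding F_op_def
    proof (intro sum.cong refl)
      fix S assume "S \<in> {S. S \<subseteq> {1..d} \<and> S \<noteq> {}}"
      hence S: "S \<subseteq> {1..d}" "S \<noteq> {}" by auto
      then obtain j where "j \<in> S" by blast
      hence "incr S z \<in> nonzero_tuples d"
        using S by (auto simp: nonzero_tuples_def incr_def z_def PiE_iff extensional_def)
      moreover have "dotp d z w = 0" by (simp add: dotp_def z_def)
      ultimately show "(- 1) ^ (d - card S) * g0 (incr S z) = (- 1) ^ (d - card S) * g (shift S)"
        by (simp add: g0_def dotp_incr[OF S(1)])
    qed
    finally show ?thesis .
  qed
  have "G summable_on nonzero_tuples d"
    by (rule summable_on_subset_banach[OF has_sum_imp_summable[OF G0]]) (use T in blast)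
  then obtain s where s: "(G has_sum s) (nonzero_tuples d)" unfolding summable_on_def by blast
  hence "(G has_sum (G z + s)) T"
    unfolding T by (intro has_sum_insert z_notin)
  from has_sum_unique[OF this G0] have "s = - F_op d g w"
    by (simp add: G_z add_eq_0_iff)
  with s show ?thesis
    by (subst has_sum_cong[where g = G]) (auto simp: G_nonzero)
qed

section \<open>Series over the lattice, holomorphic in the exponent\<close>

lemma norm_summable_rho:
  assumes "\<And>n. n \<in> nonzero_tuples d \<Longrightarrow> norm (f n :: complex) \<le> C * rho (dotp d n w) powr (- s)" "s > real d"
  shows "f summable_on nonzero_tuples d"
proof (rule abs_summable_summable, rule summable_on_comparison_test)
  show "(\<lambda>n. C * rho (dotp d n w) powr (- s)) summable_on nonzero_tuples d"
    by (intro summable_on_cmult_right summable_rho_powr assms(2))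
qed (use assms in auto)

lemma open_Re_gt: "open {\<alpha>. Re \<alpha> > \<sigma>}"
  by (rule open_halfspace_Re_gt)

lemma connected_Re_gt: "connected {\<alpha>. Re \<alpha> > \<sigma>}"
  by (intro convex_connected convex_halfspace_Re_gt)

text \<open>On a closed disc inside the half-plane, Re \<alpha> stays above some s0 > \<sigma>, so c
  + Re \<alpha> exceeds d by a fixed margin and the lattice sum converges uniformly.\<close>

lemma lattice_series_holomorphic:
  fixes f :: "(nat \<Rightarrow> nat) \<Rightarrow> complex \<Rightarrow> complex"
  assumes holo: "\<And>n. f n holomorphic_on UNIV"
    and cont: "continuous_on UNIV \<Psi>"
    and bnd: "\<And>n \<alpha>. n \<in> nonzero_tuples d \<Longrightarrow> Re \<alpha> > \<sigma> \<Longrightarrow>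
                 norm (f n \<alpha>) \<le> \<Psi> \<alpha> * rho (dotp d n w) powr (- c - Re \<alpha>)"
    and \<sigma>: "\<sigma> + c \<ge> real d"
  shows "(\<lambda>\<alpha>. \<Sum>\<^sub>\<infinity>n\<in>nonzero_tuples d. f n \<alpha>) holomorphic_on {\<alpha>. Re \<alpha> > \<sigma>}"
    and "\<And>\<alpha>. Re \<alpha> > \<sigma> \<Longrightarrow>
          ((\<lambda>n. deriv (f n) \<alpha>) has_sum deriv (\<lambda>\<alpha>. \<Sum>\<^sub>\<infinity>n\<in>nonzero_tuples d. f n \<alpha>) \<alpha>) (nonzero_tuples d)"
    and "\<And>\<alpha>. Re \<alpha> > \<sigma> \<Longrightarrow> (\<lambda>n. f n \<alpha>) summable_on nonzero_tuples d"
proof -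
  have M: "\<exists>M. M summable_on nonzero_tuples d \<and> (\<forall>n\<in>nonzero_tuples d. \<forall>x\<in>cball z r. norm (f n x) \<le> M n)"
    if r: "0 < r" "cball z r \<subseteq> {\<alpha>. Re \<alpha> > \<sigma>}" for z r
  proof -
    have "bounded (\<Psi> ` cball z r)"
      by (intro compact_imp_bounded compact_continuous_image continuous_on_subset[OF cont]) auto
    then obtain C where C: "C > 0" "\<And>x. x \<in> cball z r \<Longrightarrow> \<bar>\<Psi> x\<bar> \<le> C"
      by (auto simp: bounded_pos)
    define s0 s1 where "s0 = Re z - r" and "s1 = Re z + r"
    have "z - of_real r \<in> cball z r" using r by (simp add: dist_norm)
    hence "z - of_real r \<in> {\<alpha>. Re \<alpha> > \<sigma>}" using r by blast
    hence s0: "s0 > \<sigma>" by (simp add: s0_def)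
    have s1: "s1 > \<sigma>" using s0 r by (simp add: s0_def s1_def)
    have Re_bnd: "s0 \<le> Re x" "Re x \<le> s1" if "x \<in> cball z r" for x
      using that abs_Re_le_cmod[of "z - x"] by (auto simp: s0_def s1_def dist_norm)
    \<comment> \<open>\<open>rho\<close> of a lattice point may lie below or above 1, so its powers
      are monotone in the exponent in no fixed direction; the sum of the two endpoint powers covers
      both cases.\<close>
    have interp: "R powr t \<le> R powr a + R powr b" if "R > 0" "a \<le> t" "t \<le> b" for R t a b :: real
    proof (cases "R \<ge> 1")
      case True
      hence "R powr t \<le> R powr b" using that by (intro powr_mono) auto
      thus ?thesis by (simp add: add_increasing)
    next
      case False
      hence "R powr t \<le> R powr a" using that by (intro powr_mono') auto
      thus ?thesis by (simp add: add_increasing2)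
    qed
    define M where "M = (\<lambda>n. C * (rho (dotp d n w) powr (- (c + s1)) + rho (dotp d n w) powr (- (c + s0))))"
    have "M summable_on nonzero_tuples d"
      unfolding M_def using \<sigma> s0 s1
      by (intro summable_on_cmult_right summable_on_add summable_rho_powr) auto
    moreover have "norm (f n x) \<le> M n" if "n \<in> nonzero_tuples d" "x \<in> cball z r" for n x
    proof -
      have "norm (f n x) \<le> \<Psi> x * rho (dotp d n w) powr (- c - Re x)"
        using that r by (intro bnd) auto
      also have "\<dots> \<le> C * (rho (dotp d n w) powr (- (c + s1)) + rho (dotp d n w) powr (- (c + s0)))"
        using C(1) C(2)[OF that(2)] Re_bnd[OF that(2)] dotp_in_H[OF that(1)]
        by (intro mult_mono interp) (auto simp: H_iff)
      finally show ?thesis by (simp add: M_def)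
    qed
    ultimately show ?thesis by blast
  qed
  note * = infsum_holomorphic[OF open_Re_gt holomorphic_on_subset[OF holo subset_UNIV] M, simplified]
  show "(\<lambda>\<alpha>. \<Sum>\<^sub>\<infinity>n\<in>nonzero_tuples d. f n \<alpha>) holomorphic_on {\<alpha>. Re \<alpha> > \<sigma>}"
    using *(1) .
  show "((\<lambda>n. deriv (f n) \<alpha>) has_sum deriv (\<lambda>\<alpha>. \<Sum>\<^sub>\<infinity>n\<in>nonzero_tuples d. f n \<alpha>) \<alpha>) (nonzero_tuples d)"
    if "Re \<alpha> > \<sigma>" for \<alpha> using *(2) that by simp
  show "(\<lambda>n. f n \<alpha>) summable_on nonzero_tuples d" if "Re \<alpha> > \<sigma>" for \<alpha>
    using *(3) that by simp
qed

definition dirichlet :: "complex \<Rightarrow> complex" where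
  "dirichlet \<alpha> = (\<Sum>\<^sub>\<infinity>n\<in>nonzero_tuples d. exp (- \<alpha> * lg (dotp d n w)))"

lemma dirichlet:
  shows "dirichlet holomorphic_on {\<alpha>. Re \<alpha> > real d}"
    and "Re \<alpha> > real d \<Longrightarrow>
           ((\<lambda>n. exp (- \<alpha> * lg (dotp d n w))) has_sum dirichlet \<alpha>) (nonzero_tuples d)"
proof -
  obtain \<Psi> where \<Psi>: "continuous_on UNIV \<Psi>"
    "\<And>\<alpha> y. y \<in> H \<Longrightarrow> real d \<le> Re \<alpha> \<Longrightarrow> norm (hp 0 \<alpha> y) \<le> \<Psi> \<alpha> * rho y powr (real d - Re \<alpha>)"
    using norm_hp_le[of 0] by auto
  \<comment> \<open>The terms of the series are \<open>hp 0\<close> at \<alpha> + d, so its bound is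
    reused after this shift.\<close>
  have cont: "continuous_on UNIV (\<lambda>\<alpha>. \<Psi> (\<alpha> + of_nat d))"
    by (rule continuous_on_compose2[OF \<Psi>(1)]) (auto intro!: continuous_intros)
  have bnd: "norm (exp (- \<alpha> * lg (dotp d n w))) \<le> \<Psi> (\<alpha> + of_nat d) * rho (dotp d n w) powr (- 0 - Re \<alpha>)"
    if "n \<in> nonzero_tuples d" "Re \<alpha> > real d" for n \<alpha>
    using \<Psi>(2)[OF dotp_in_H[OF that(1)], of "\<alpha> + of_nat d"] that by (simp add: hp_def)
  have holo: "(\<lambda>\<alpha>. exp (- \<alpha> * lg (dotp d n w))) holomorphic_on UNIV" for n
    by (intro holomorphic_intros)
  note * = lattice_series_holomorphic[where f = "\<lambda>n \<alpha>. exp (- \<alpha> * lg (dotp d n w))", OF holo cont bnd, of "real d", simplified]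
  show "dirichlet holomorphic_on {\<alpha>. Re \<alpha> > real d}"
    using *(1) unfolding dirichlet_def[abs_def] by simp
  show "((\<lambda>n. exp (- \<alpha> * lg (dotp d n w))) has_sum dirichlet \<alpha>) (nonzero_tuples d)"
    if "Re \<alpha> > real d"
    unfolding dirichlet_def using *(3) that by simp
qed

section \<open>Clearing the poles and gluing the continuation\<close>

definition pole_factor :: "complex \<Rightarrow> complex" where
  "pole_factor \<alpha> = (\<Prod>j<d. of_nat d - of_nat j - \<alpha>)"

lemma hp_d: "hp d \<alpha> y = pole_factor \<alpha> * exp (- \<alpha> * lg y)"
  by (simp add: hp_def pole_factor_def)

lemma pole_factor_holomorphic: "pole_factor holomorphic_on A"
  unfolding pole_factor_def[abs_def] by (intro holomorphic_intros)

lemma pole_factor_neq_0: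
  assumes "Re \<alpha> > real d"
  shows "pole_factor \<alpha> \<noteq> 0"
proof -
  have "of_nat d - of_nat j - \<alpha> \<noteq> 0" for j
  proof
    assume "of_nat d - of_nat j - \<alpha> = 0"
    from arg_cong[OF this, of Re] show False using assms by simp
  qed
  thus ?thesis by (simp add: pole_factor_def)
qed

lemma tail_holomorphic: "(\<lambda>\<alpha>. tail K \<alpha> y) holomorphic_on A"
  unfolding tail_def G_op_altdef by (intro holomorphic_intros hp_holomorphic)

definition boundary :: "nat \<Rightarrow> complex \<Rightarrow> complex" where
  "boundary K \<alpha> = (\<Sum>m\<le>K. fps_nth (recip_fps d w) m * F_op d (hp m \<alpha>) w)"

lemma boundary_holomorphic: "boundary K holomorphic_on A"
  unfolding boundary_def[abs_def] F_op_def by (intro holomorphic_intros hp_holomorphic)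

definition tail_sum :: "nat \<Rightarrow> complex \<Rightarrow> complex" where
  "tail_sum K \<alpha> = (\<Sum>\<^sub>\<infinity>n\<in>nonzero_tuples d. tail K \<alpha> (dotp d n w))"

lemma tail_sum:
  shows "tail_sum K holomorphic_on {\<alpha>. Re \<alpha> > real d - real (Suc K)}"
    and "Re \<alpha> > real d - real (Suc K) \<Longrightarrow>
          ((\<lambda>n. deriv (\<lambda>\<alpha>. tail K \<alpha> (dotp d n w)) \<alpha>) has_sum deriv (tail_sum K) \<alpha>) (nonzero_tuples d)"
    and "Re \<alpha> > real d - real (Suc K) \<Longrightarrow>
          ((\<lambda>n. tail K \<alpha> (dotp d n w)) has_sum tail_sum K \<alpha>) (nonzero_tuples d)"
proof -
  obtain \<Psi> where \<Psi>: "continuous_on UNIV \<Psi>"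
    "\<And>\<alpha> y. y \<in> H \<Longrightarrow> - real (Suc K) \<le> Re \<alpha> \<Longrightarrow>
       norm (tail K \<alpha> y) \<le> \<Psi> \<alpha> * rho y powr (- real (Suc K) - Re \<alpha>)"
    using norm_tail_le[of K] by blast
  have bnd: "norm (tail K \<alpha> (dotp d n w)) \<le> \<Psi> \<alpha> * rho (dotp d n w) powr (- real (Suc K) - Re \<alpha>)"
    if "n \<in> nonzero_tuples d" "Re \<alpha> > real d - real (Suc K)" for n \<alpha>
    using that by (intro \<Psi>(2) dotp_in_H) auto
  have "real d - real (Suc K) + real (Suc K) \<ge> real d" by simp
  note * = lattice_series_holomorphic[where f = "\<lambda>n \<alpha>. tail K \<alpha> (dotp d n w)", OF tail_holomorphic \<Psi>(1) bnd this]
  have eq: "tail_sum K = (\<lambda>\<alpha>. \<Sum>\<^sub>\<infinity>n\<in>nonzero_tuples d. tail K \<alpha> (dotp d n w))"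
    by (rule ext) (simp add: tail_sum_def)
  show "tail_sum K holomorphic_on {\<alpha>. Re \<alpha> > real d - real (Suc K)}"
    unfolding eq by (rule *(1))
  show "((\<lambda>n. deriv (\<lambda>\<alpha>. tail K \<alpha> (dotp d n w)) \<alpha>) has_sum deriv (tail_sum K) \<alpha>) (nonzero_tuples d)"
    if "Re \<alpha> > real d - real (Suc K)" unfolding eq by (intro *(2) that)
  show "((\<lambda>n. tail K \<alpha> (dotp d n w)) has_sum tail_sum K \<alpha>) (nonzero_tuples d)"
    if "Re \<alpha> > real d - real (Suc K)"
    unfolding eq by (intro has_sum_infsum *(3) that)
qed

text \<open>The candidate for \<open>pole_factor\<close> times the zeta function on Re \<alpha> > d
  - K - 1.\<close>

definition E :: "nat \<Rightarrow> complex \<Rightarrow> complex" where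
  "E K \<alpha> = tail_sum K \<alpha> - boundary K \<alpha>"

lemma E_holomorphic: "E K holomorphic_on {\<alpha>. Re \<alpha> > real d - real (Suc K)}"
  unfolding E_def[abs_def] by (intro holomorphic_intros tail_sum boundary_holomorphic)

text \<open>Beyond 2d every \<open>hp m\<close> is summable over the lattice, even the largest, m =
  0, of size rho powr (d - Re \<alpha>). Hence \<open>has_sum_G_op\<close> applies to each m
  separately.\<close>

lemma E_eq_far:
  assumes "Re \<alpha> > 2 * real d"
  shows "E K \<alpha> = pole_factor \<alpha> * dirichlet \<alpha>"
proof -
  let ?u = "fps_nth (recip_fps d w)"
  have gt: "Re \<alpha> > real d" "Re \<alpha> > real d - real (Suc K)" using assms by auto
  have "(\<lambda>n. hp m \<alpha> (dotp d n w)) summable_on nonzero_tuples d" for m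
  proof -
    obtain \<Psi> where \<Psi>: "\<And>\<alpha> y. y \<in> H \<Longrightarrow> real d - real m \<le> Re \<alpha> \<Longrightarrow>
       norm (hp m \<alpha> y) \<le> \<Psi> \<alpha> * rho y powr (real d - real m - Re \<alpha>)"
      using norm_hp_le[of m] by blast
    show ?thesis
    proof (rule norm_summable_rho)
      show "norm (hp m \<alpha> (dotp d n w)) \<le> \<Psi> \<alpha> * rho (dotp d n w) powr (- (Re \<alpha> + real m - real d))"
        if "n \<in> nonzero_tuples d" for n
        using \<Psi>[OF dotp_in_H[OF that], of \<alpha>] assms by (simp add: algebra_simps)
    qed (use assms in auto)
  qed
  hence G: "((\<lambda>n. G_op d (\<lambda>x. hp m \<alpha> (dotp d n w + x)) w) has_sum - F_op d (hp m \<alpha>) w) (nonzero_tuples d)" for m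
    by (rule has_sum_G_op)
  have D: "((\<lambda>n. hp d \<alpha> (dotp d n w)) has_sum pole_factor \<alpha> * dirichlet \<alpha>) (nonzero_tuples d)"
    unfolding hp_d by (intro has_sum_cmult_right dirichlet gt)
  have "((\<lambda>n. hp d \<alpha> (dotp d n w) - (\<Sum>m\<le>K. ?u m * G_op d (\<lambda>x. hp m \<alpha> (dotp d n w + x)) w)) has_sum
          (pole_factor \<alpha> * dirichlet \<alpha> - (\<Sum>m\<le>K. ?u m * - F_op d (hp m \<alpha>) w))) (nonzero_tuples d)"
    by (intro has_sum_diff has_sum_finite_sum has_sum_cmult_right G D) auto
  hence "((\<lambda>n. tail K \<alpha> (dotp d n w)) has_sum (pole_factor \<alpha> * dirichlet \<alpha> + boundary K \<alpha>)) (nonzero_tuples d)"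
    unfolding tail_def boundary_def by (simp add: sum_negf)
  hence "tail_sum K \<alpha> = pole_factor \<alpha> * dirichlet \<alpha> + boundary K \<alpha>"
    by (rule has_sum_unique[OF tail_sum(3)[OF gt(2)]])
  thus ?thesis by (simp add: E_def)
qed

lemma E_eq:
  assumes "Re \<alpha> > real d"
  shows "E K \<alpha> = pole_factor \<alpha> * dirichlet \<alpha>"
proof (rule analytic_continuation_open[where f = "E K" and g = "\<lambda>\<alpha>. pole_factor \<alpha> * dirichlet \<alpha>" and s = "{\<alpha>. Re \<alpha> > 2 * real d}" and s' = "{\<alpha>. Re \<alpha> > real d}"])
  have "of_nat (2 * d + 1) \<in> {\<alpha>. Re \<alpha> > 2 * real d}" by simp
  thus "{\<alpha>. Re \<alpha> > 2 * real d} \<noteq> {}" by blast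
  show "E K holomorphic_on {\<alpha>. Re \<alpha> > real d}"
    by (rule holomorphic_on_subset[OF E_holomorphic]) auto
  show "(\<lambda>\<alpha>. pole_factor \<alpha> * dirichlet \<alpha>) holomorphic_on {\<alpha>. Re \<alpha> > real d}"
    by (intro holomorphic_intros pole_factor_holomorphic dirichlet)
qed (use assms E_eq_far in \<open>auto simp: open_Re_gt connected_Re_gt\<close>)

text \<open>Both functions equal \<open>pole_factor\<close> times the Dirichlet series for Re
  \<alpha> > d; the identity theorem extends this to the smaller of the two half-planes.\<close>

lemma E_indep:
  assumes "K \<le> K'" "Re \<alpha> > real d - real (Suc K)"
  shows "E K \<alpha> = E K' \<alpha>"
proof (rule analytic_continuation_open[where f = "E K" and g = "E K'" and s = "{\<alpha>. Re \<alpha> > real d}" and s' = "{\<alpha>. Re \<alpha> > real d - real (Suc K)}"])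
  have "of_nat (d + 1) \<in> {\<alpha>. Re \<alpha> > real d}" by simp
  thus "{\<alpha>. Re \<alpha> > real d} \<noteq> {}" by blast
  show "E K' holomorphic_on {\<alpha>. Re \<alpha> > real d - real (Suc K)}"
    by (rule holomorphic_on_subset[OF E_holomorphic]) (use assms in auto)
qed (use assms E_holomorphic[of K] in \<open>auto simp: open_Re_gt connected_Re_gt E_eq\<close>)

text \<open>The index is large enough for \<alpha> to lie in the half-plane of \<open>E\<close>; by
  \<open>E_indep\<close> the choice is immaterial, so the pieces glue to a holomorphic
  function.\<close>

definition entire :: "complex \<Rightarrow> complex" where
  "entire \<alpha> = E (nat \<lceil>real d - Re \<alpha>\<rceil>) \<alpha>"

lemma entire_eq:
  assumes "Re \<alpha> > real d - real (Suc K)"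
  shows "entire \<alpha> = E K \<alpha>"
proof -
  define K' where "K' = nat \<lceil>real d - Re \<alpha>\<rceil>"
  have "real K' \<ge> real d - Re \<alpha>" unfolding K'_def by linarith
  hence "Re \<alpha> > real d - real (Suc K')" by simp
  hence "E K' \<alpha> = E K \<alpha>"
    using E_indep[of K K' \<alpha>] E_indep[of K' K \<alpha>] assms by (metis nat_le_linear)
  thus ?thesis
    by (simp only: entire_def K'_def)
qed

lemma entire_holomorphic: "entire holomorphic_on UNIV"
proof -
  have "entire holomorphic_on (\<Union>K. {\<alpha>. Re \<alpha> > real d - real (Suc K)})"
  proof (rule holomorphic_on_UN_open)
    show "entire holomorphic_on {\<alpha>. Re \<alpha> > real d - real (Suc K)}" for K
      by (rule holomorphic_transform[OF E_holomorphic]) (simp add: entire_eq)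
  qed (rule open_Re_gt)
  moreover have "(\<Union>K. {\<alpha>. Re \<alpha> > real d - real (Suc K)}) = UNIV"
  proof (intro equalityI subsetI UN_I)
    fix \<alpha> :: complex
    have "real (nat \<lceil>real d - Re \<alpha>\<rceil>) \<ge> real d - Re \<alpha>" by linarith
    thus "\<alpha> \<in> {z. Re z > real d - real (Suc (nat \<lceil>real d - Re \<alpha>\<rceil>))}" by simp
  qed auto
  ultimately show ?thesis by simp
qed

lemma quotient_meromorphic: "(\<lambda>\<alpha>. entire \<alpha> / pole_factor \<alpha>) meromorphic_on UNIV"
proof (intro meromorphic_on_divide analytic_on_imp_meromorphic_on)
  show "entire analytic_on UNIV" "pole_factor analytic_on UNIV"
    using entire_holomorphic pole_factor_holomorphic[of UNIV] by (simp_all only: analytic_on_open[OF open_UNIV])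
qed

text \<open>The quotient with its singularities removed satisfies the definite description, and
  \<open>nicely_meromorphic_on_UNIV_eqI\<close> excludes any other function, as the values for Re
  \<alpha> > d are forced by the series.\<close>

lemma barnes_zeta_hom_eq:
  "barnes_zeta_hom lg d w = remove_sings (\<lambda>\<alpha>. entire \<alpha> / pole_factor \<alpha>)" (is "_ = ?Z")
  unfolding barnes_zeta_hom_def
proof (rule the_equality)
  have nice: "?Z nicely_meromorphic_on UNIV"
    by (intro remove_sings_nicely_meromorphic quotient_meromorphic)
  have Z: "?Z \<alpha> = dirichlet \<alpha>" if "Re \<alpha> > real d" for \<alpha>
  proof -
    have "(\<lambda>\<alpha>. entire \<alpha> / pole_factor \<alpha>) analytic_on {\<alpha>. Re \<alpha> > real d}"
      unfolding analytic_on_open[OF open_Re_gt]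
      by (intro holomorphic_on_divide pole_factor_holomorphic holomorphic_on_subset[OF entire_holomorphic])
         (auto simp: pole_factor_neq_0)
    hence "?Z \<alpha> = entire \<alpha> / pole_factor \<alpha>"
      using that by (intro remove_sings_at_analytic) (rule analytic_on_subset, auto)
    also have "entire \<alpha> = pole_factor \<alpha> * dirichlet \<alpha>"
      using that by (simp add: entire_eq[where K = 0] E_eq)
    finally show ?thesis using pole_factor_neq_0[OF that] by simp
  qed
  show "?Z nicely_meromorphic_on UNIV \<and>
    (\<forall>\<alpha>. real d < Re \<alpha> \<longrightarrow> ((\<lambda>n. exp (- \<alpha> * lg (dotp d n w))) has_sum ?Z \<alpha>) (nonzero_tuples d))"
    using nice Z dirichlet(2) by simp
  fix Z' assume Z': "Z' nicely_meromorphic_on UNIV \<and>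
    (\<forall>\<alpha>. real d < Re \<alpha> \<longrightarrow> ((\<lambda>n. exp (- \<alpha> * lg (dotp d n w))) has_sum Z' \<alpha>) (nonzero_tuples d))"
  show "Z' = ?Z"
  proof (rule nicely_meromorphic_on_UNIV_eqI)
    show "open {\<alpha>. Re \<alpha> > real d}" by (rule open_Re_gt)
    show "of_nat (d + 1) \<in> {\<alpha>. Re \<alpha> > real d}" by simp
    show "Z' \<alpha> = ?Z \<alpha>" if "\<alpha> \<in> {\<alpha>. Re \<alpha> > real d}" for \<alpha>
    proof -
      have gt: "real d < Re \<alpha>" using that by simp
      have "((\<lambda>n. exp (- \<alpha> * lg (dotp d n w))) has_sum Z' \<alpha>) (nonzero_tuples d)"
        using Z' gt by blast
      from has_sum_unique[OF this dirichlet(2)[OF gt]] show ?thesis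
        by (simp only: Z[OF gt])
    qed
  qed (use Z' nice in blast)+
qed

end

section \<open>The finite part\<close>

lemma DERIV_G_op:
  assumes "\<And>S. S \<subseteq> {1..d} \<Longrightarrow> ((\<lambda>\<alpha>. f \<alpha> (\<Sum>i\<in>S. v i)) has_field_derivative f' (\<Sum>i\<in>S. v i)) (at a)"
  shows "((\<lambda>\<alpha>. G_op d (f \<alpha>) v) has_field_derivative G_op d f' v) (at a)"
  unfolding G_op_altdef by (intro DERIV_sum DERIV_cmult assms) auto

lemma DERIV_F_op:
  assumes "\<And>S. S \<subseteq> {1..d} \<Longrightarrow> S \<noteq> {} \<Longrightarrow>
             ((\<lambda>\<alpha>. f \<alpha> (\<Sum>i\<in>S. v i)) has_field_derivative f' (\<Sum>i\<in>S. v i)) (at a)"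
  shows "((\<lambda>\<alpha>. F_op d (f \<alpha>) v) has_field_derivative F_op d f' v) (at a)"
  unfolding F_op_def by (intro DERIV_sum DERIV_cmult assms) auto

lemma F_op_cmult: "F_op d (\<lambda>x. c * g x) v = c * F_op d g v"
  by (simp add: F_op_def sum_distrib_left mult_ac)

lemma F_op_diff: "F_op d (\<lambda>x. f x - g x) v = F_op d f v - F_op d g v"
  by (simp add: F_op_def sum_subtractf algebra_simps)

section \<open>Splitting the factor at q off \<open>pole_factor\<close>\<close>

definition rising :: "nat \<Rightarrow> complex \<Rightarrow> complex" where
  "rising k x = (\<Prod>i=1..k. of_nat i + x)"

lemma rising_0 [simp]: "rising 0 x = 1"
  by (simp add: rising_def)

lemma rising_Suc: "rising (Suc k) x = rising k x * (of_nat (Suc k) + x)"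
  by (simp add: rising_def)

lemma rising_at_0 [simp]: "rising k 0 = fact k"
  by (simp add: rising_def fact_prod)

lemma DERIV_rising: "(rising k has_field_derivative fact k * harm k) (at 0)"
  using has_field_derivative_prod_of_nat_add[of k] unfolding rising_def[abs_def] .

lemma rising_holomorphic:
  assumes "f holomorphic_on A"
  shows "(\<lambda>x. rising k (f x)) holomorphic_on A"
  unfolding rising_def by (intro holomorphic_intros assms)

locale barnes_pole = barnes +
  fixes q :: nat
  assumes q: "q \<in> {1..d}"
begin

definition K :: nat where "K = d - q"

text \<open>\<open>pole_factor\<close> divided by \<alpha> - q. The factors j - \<alpha> with j > q
  form the first \<open>rising\<close>, those with j < q form the second at the cost of q - 1 signs,
  and j = q supplies one more sign.\<close>

definition cofactor :: "complex \<Rightarrow> complex" where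
  "cofactor \<alpha> = (- 1) ^ q * rising K (of_nat q - \<alpha>) * rising (q - 1) (\<alpha> - of_nat q)"

text \<open>For m \<le> K the factors contained in \<open>hp m\<close> all belong to some j > q.
  They therefore divide \<open>cofactor\<close> and can be cancelled against it.\<close>

lemma rising_K:
  assumes "m \<le> K"
  shows "rising K (of_nat q - \<alpha>) = (\<Prod>j<m. of_nat d - of_nat j - \<alpha>) * rising (K - m) (of_nat q - \<alpha>)"
  using assms
proof (induction m)
  case (Suc m)
  have km: "K - m = Suc (K - Suc m)" using Suc.prems by simp
  have "of_nat (K - m) = (of_nat d - of_nat q - of_nat m :: complex)"
    using Suc.prems q by (simp add: K_def of_nat_diff)
  hence "of_nat (Suc (K - Suc m)) + (of_nat q - \<alpha>) = of_nat d - of_nat m - \<alpha>"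
    unfolding km by (simp only: diff_conv_add_uminus ac_simps) simp
  hence "rising (K - m) (of_nat q - \<alpha>) = rising (K - Suc m) (of_nat q - \<alpha>) * (of_nat d - of_nat m - \<alpha>)"
    by (simp only: km rising_Suc)
  thus ?case using Suc by simp
qed simp

lemma pole_factor_eq: "pole_factor \<alpha> = (\<alpha> - of_nat q) * cofactor \<alpha>"
proof -
  have *: "(\<Prod>j<K + Suc r. of_nat d - of_nat j - \<alpha>) =
      rising K (of_nat q - \<alpha>) * (of_nat q - \<alpha>) * (- 1) ^ r * rising r (\<alpha> - of_nat q)" if "r < q" for r
    using that
  proof (induction r)
    case 0
    have "of_nat d - of_nat K = (of_nat q :: complex)"
      using q by (simp add: K_def of_nat_diff)
    thus ?case using rising_K[of K \<alpha>] by simp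
  next
    case (Suc r)
    have f: "of_nat d - of_nat (K + Suc r) - \<alpha> = - (of_nat (Suc r) + (\<alpha> - of_nat q))"
      using q by (simp add: K_def of_nat_diff)
    have "(\<Prod>j<K + Suc (Suc r). of_nat d - of_nat j - \<alpha>) =
        (\<Prod>j<K + Suc r. of_nat d - of_nat j - \<alpha>) * - (of_nat (Suc r) + (\<alpha> - of_nat q))"
      by (simp only: add_Suc_right prod.lessThan_Suc f [unfolded add_Suc_right])
    also have "(\<Prod>j<K + Suc r. of_nat d - of_nat j - \<alpha>) =
        rising K (of_nat q - \<alpha>) * (of_nat q - \<alpha>) * (- 1) ^ r * rising r (\<alpha> - of_nat q)"
      by (rule Suc.IH[OF Suc_lessD[OF Suc.prems]])
    finally show ?case
      by (simp only: rising_Suc power_Suc mult_minus_left mult_minus_right mult_1_left mult.assoc)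
  qed
  have "K + Suc (q - 1) = d" using q by (auto simp: K_def)
  moreover have "(- 1) ^ q = - ((- 1) ^ (q - 1) :: complex)" using q by (cases q) auto
  ultimately show ?thesis
    using *[of "q - 1"] q by (simp add: pole_factor_def cofactor_def algebra_simps)
qed

lemma cofactor_holomorphic: "cofactor holomorphic_on A"
  unfolding cofactor_def[abs_def] by (intro holomorphic_intros rising_holomorphic)

lemma cofactor_neq_0: "cofactor (of_nat q) \<noteq> 0"
  by (simp add: cofactor_def)

lemma eventually_cofactor_neq_0: "eventually (\<lambda>\<alpha>. cofactor \<alpha> \<noteq> 0) (nhds (of_nat q))"
proof -
  have "isCont cofactor (of_nat q)"
    using cofactor_holomorphic[of UNIV] holomorphic_on_imp_continuous_on continuous_on_eq_continuous_at
    by blast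
  hence "eventually (\<lambda>\<alpha>. cofactor \<alpha> \<noteq> 0) (at (of_nat q))"
    using cofactor_neq_0 unfolding isCont_def by (rule tendsto_imp_eventually_ne)
  thus ?thesis
    using cofactor_neq_0 by (simp add: eventually_nhds_conv_at)
qed

lemma Re_q: "Re (of_nat q) > real d - real (Suc K)"
  using q by (simp add: K_def of_nat_diff)

lemma finite_part_eq: "finite_part (barnes_zeta_hom lg d w) (of_nat q) = deriv (\<lambda>\<alpha>. E K \<alpha> / cofactor \<alpha>) (of_nat q)"
proof -
  have an: "(\<lambda>\<alpha>. entire \<alpha> / cofactor \<alpha>) analytic_on {of_nat q}"
    using cofactor_neq_0 entire_holomorphic cofactor_holomorphic[of UNIV]
    by (intro analytic_on_divide) (auto intro: analytic_on_subset[of _ UNIV] simp: analytic_on_open)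
  have "eventually (\<lambda>\<alpha>. barnes_zeta_hom lg d w \<alpha> = entire \<alpha> / pole_factor \<alpha>) (at (of_nat q))"
    unfolding barnes_zeta_hom_eq
    by (intro eventually_remove_sings_eq_at) (use quotient_meromorphic in \<open>auto simp: meromorphic_on_altdef\<close>)
  hence "eventually (\<lambda>\<alpha>. barnes_zeta_hom lg d w \<alpha> = entire \<alpha> / cofactor \<alpha> / (\<alpha> - of_nat q)) (at (of_nat q))"
    by eventually_elim (simp add: pole_factor_eq mult.commute)
  with an have "finite_part (barnes_zeta_hom lg d w) (of_nat q) = deriv (\<lambda>\<alpha>. entire \<alpha> / cofactor \<alpha>) (of_nat q)"
    by (rule finite_part_div_linear)
  also have "\<dots> = deriv (\<lambda>\<alpha>. E K \<alpha> / cofactor \<alpha>) (of_nat q)"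
  proof (rule deriv_cong_ev[OF _ refl])
    have "eventually (\<lambda>\<alpha>. \<alpha> \<in> {\<alpha>. Re \<alpha> > real d - real (Suc K)}) (nhds (of_nat q))"
      by (intro eventually_nhds_in_open open_Re_gt) (use Re_q in simp)
    thus "eventually (\<lambda>\<alpha>. entire \<alpha> / cofactor \<alpha> = E K \<alpha> / cofactor \<alpha>) (nhds (of_nat q))"
      by eventually_elim (simp add: entire_eq)
  qed
  finally show ?thesis .
qed

text \<open>For m \<le> K and y in \<open>H\<close>, the finite part at q of
  \<open>hp m \<alpha> y / pole_factor \<alpha>\<close>. The logarithm comes from differentiating
  the power, the harmonic difference from differentiating what is left of
  \<open>cofactor\<close>.\<close>

definition hp_fp :: "nat \<Rightarrow> complex \<Rightarrow> complex" where
  "hp_fp m y = (- 1) ^ (q - 1) / (fact (q - 1) * fact (K - m)) *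
     (y ^ (K - m) * lg y - (harm (K - m) - harm (q - 1)) * y ^ (K - m))"

lemma exp_of_nat_mult_lg: "y \<in> H \<Longrightarrow> exp (of_nat k * lg y) = y ^ k"
  by (simp add: exp_of_nat_mult exp_lg)

lemma DERIV_hp_div_cofactor:
  assumes "m \<le> K" "y \<in> H"
  shows "((\<lambda>\<alpha>. hp m \<alpha> y / cofactor \<alpha>) has_field_derivative hp_fp m y) (at (of_nat q))"
proof -
  define k where "k = K - m"
  \<comment> \<open>Up to sign, this is what \<open>cofactor\<close> keeps after the factors of
    \<open>hp m\<close> are cancelled.\<close>
  define N where "N = (\<lambda>\<alpha>. rising k (of_nat q - \<alpha>) * rising (q - 1) (\<alpha> - of_nat q))"
  define e where "e = (\<lambda>\<alpha>. exp ((of_nat d - of_nat m - \<alpha>) * lg y))"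
  have "d = k + m + q" using assms q by (auto simp: k_def K_def)
  hence k: "of_nat d - of_nat m - of_nat q = (of_nat k :: complex)" by simp
  have e: "(e has_field_derivative - (lg y) * y ^ k) (at (of_nat q))"
  proof -
    have "(e has_field_derivative exp (of_nat k * lg y) * (- (lg y))) (at (of_nat q))"
      unfolding e_def by (auto intro!: derivative_eq_intros simp: k)
    thus ?thesis using assms(2) by (simp add: exp_of_nat_mult_lg mult.commute)
  qed
  have e_q: "e (of_nat q) = y ^ k"
    using assms(2) by (simp add: e_def k exp_of_nat_mult_lg)
  have 1: "((\<lambda>\<alpha>. rising k (of_nat q - \<alpha>)) has_field_derivative (fact k * harm k) * (0 - 1)) (at (of_nat q))"
    by (rule DERIV_chain2[of "rising k"]) (auto intro!: derivative_eq_intros DERIV_rising)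
  have 2: "((\<lambda>\<alpha>. rising (q - 1) (\<alpha> - of_nat q)) has_field_derivative (fact (q - 1) * harm (q - 1)) * (1 - 0)) (at (of_nat q))"
    by (rule DERIV_chain2[of "rising (q - 1)"]) (auto intro!: derivative_eq_intros DERIV_rising)
  have N: "(N has_field_derivative fact k * fact (q - 1) * (harm (q - 1) - harm k)) (at (of_nat q))"
    unfolding N_def by (rule DERIV_cong[OF DERIV_mult[OF 1 2]]) (simp add: algebra_simps)
  have N_q: "N (of_nat q) = fact k * fact (q - 1)" by (simp add: N_def)
  have "((\<lambda>\<alpha>. (- 1) ^ q * (e \<alpha> / N \<alpha>)) has_field_derivative
      (- 1) ^ q * ((- (lg y) * y ^ k * N (of_nat q) - e (of_nat q) * (fact k * fact (q - 1) * (harm (q - 1) - harm k))) / (N (of_nat q) * N (of_nat q)))) (at (of_nat q))"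
    by (intro DERIV_cmult DERIV_divide e N) (simp add: N_q)
  also have "(- 1) ^ q * ((- (lg y) * y ^ k * N (of_nat q) - e (of_nat q) * (fact k * fact (q - 1) * (harm (q - 1) - harm k))) / (N (of_nat q) * N (of_nat q))) = hp_fp m y"
  proof -
    have "(- 1) ^ q = - ((- 1) ^ (q - 1) :: complex)" using q by (cases q) auto
    thus ?thesis
      unfolding N_q e_q hp_fp_def k_def[symmetric] by (simp add: field_simps)
  qed
  finally have *: "((\<lambda>\<alpha>. (- 1) ^ q * (e \<alpha> / N \<alpha>)) has_field_derivative hp_fp m y) (at (of_nat q))" .
  \<comment> \<open>The cancellation is valid where \<open>cofactor\<close> is nonzero, hence near
    q, which suffices for the derivative.\<close>
  have "eventually (\<lambda>\<alpha>. hp m \<alpha> y / cofactor \<alpha> = (- 1) ^ q * (e \<alpha> / N \<alpha>)) (nhds (of_nat q))"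
    using eventually_cofactor_neq_0
  proof eventually_elim
    case (elim \<alpha>)
    define P where "P = (\<Prod>j<m. of_nat d - of_nat j - \<alpha>)"
    have c: "cofactor \<alpha> = (- 1) ^ q * P * N \<alpha>"
      unfolding cofactor_def rising_K[OF assms(1)] N_def P_def k_def by (simp only: mult_ac)
    have "P \<noteq> 0" using elim unfolding c by auto
    moreover have "(- 1) ^ q * ((- 1) ^ q * x) = (x :: complex)" for x
      by (cases "even q") auto
    moreover have "hp m \<alpha> y = P * e \<alpha>" by (simp add: hp_def P_def e_def)
    ultimately show ?case unfolding c using elim c by (simp add: field_simps)
  qed
  thus ?thesis using * by (subst DERIV_cong_ev[OF refl _ refl])
qed

text \<open>\<open>hp d\<close> contains the whole \<open>pole_factor\<close>, so near q the
  quotient is (\<alpha> - q) y^(-\<alpha>). It vanishes at q, and no logarithm survives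
  differentiation.\<close>

lemma DERIV_hp_d_div_cofactor:
  assumes "y \<in> H"
  shows "((\<lambda>\<alpha>. hp d \<alpha> y / cofactor \<alpha>) has_field_derivative 1 / y ^ q) (at (of_nat q))"
proof -
  have "((\<lambda>\<alpha>. (\<alpha> - of_nat q) * exp (- \<alpha> * lg y)) has_field_derivative exp (- of_nat q * lg y)) (at (of_nat q))"
    by (auto intro!: derivative_eq_intros)
  moreover have "exp (- of_nat q * lg y) = 1 / y ^ q"
    using exp_of_nat_mult_lg[OF assms, of q] by (simp add: exp_minus field_simps)
  moreover have "eventually (\<lambda>\<alpha>. hp d \<alpha> y / cofactor \<alpha> = (\<alpha> - of_nat q) * exp (- \<alpha> * lg y)) (nhds (of_nat q))"
    using eventually_cofactor_neq_0 by eventually_elim (simp add: hp_d pole_factor_eq)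
  ultimately show ?thesis by (subst DERIV_cong_ev[OF refl _ refl]) simp_all
qed

definition tail_fp :: "complex \<Rightarrow> complex" where
  "tail_fp y = 1 / y ^ q - (\<Sum>m\<le>K. fps_nth (recip_fps d w) m * G_op d (\<lambda>x. hp_fp m (y + x)) w)"

lemma DERIV_tail_div_cofactor:
  assumes "y \<in> H"
  shows "((\<lambda>\<alpha>. tail K \<alpha> y / cofactor \<alpha>) has_field_derivative tail_fp y) (at (of_nat q))"
proof -
  have "tail K \<alpha> y / cofactor \<alpha> = hp d \<alpha> y / cofactor \<alpha> -
      (\<Sum>m\<le>K. fps_nth (recip_fps d w) m * G_op d (\<lambda>x. hp m \<alpha> (y + x) / cofactor \<alpha>) w)" for \<alpha>
    using G_op_cmult[where c = "1 / cofactor \<alpha>"]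
    by (simp add: tail_def diff_divide_distrib sum_divide_distrib)
  thus ?thesis
    unfolding tail_fp_def
    by (auto intro!: DERIV_diff DERIV_hp_d_div_cofactor DERIV_sum DERIV_cmult DERIV_G_op
          DERIV_hp_div_cofactor add_shift_in_H assms)
qed

definition boundary_fp :: complex where
  "boundary_fp = (\<Sum>m\<le>K. fps_nth (recip_fps d w) m * F_op d (hp_fp m) w)"

lemma DERIV_boundary_div_cofactor:
  "((\<lambda>\<alpha>. boundary K \<alpha> / cofactor \<alpha>) has_field_derivative boundary_fp) (at (of_nat q))"
proof -
  have "boundary K \<alpha> / cofactor \<alpha> =
      (\<Sum>m\<le>K. fps_nth (recip_fps d w) m * F_op d (\<lambda>x. hp m \<alpha> x / cofactor \<alpha>) w)" for \<alpha>
    using F_op_cmult[where c = "1 / cofactor \<alpha>"]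
    by (simp add: boundary_def sum_divide_distrib)
  thus ?thesis
    unfolding boundary_fp_def
    by (auto intro!: DERIV_sum DERIV_cmult DERIV_F_op DERIV_hp_div_cofactor shift_in_H)
qed

text \<open>By the quotient rule each term is the same linear combination of the \<alpha>-derivative
  and the value of \<open>tail\<close> at q. Both series converge by \<open>tail_sum\<close>, since
  q lies in its half-plane.\<close>

lemma has_sum_tail_fp:
  "((\<lambda>n. tail_fp (dotp d n w)) has_sum deriv (\<lambda>\<alpha>. tail_sum K \<alpha> / cofactor \<alpha>) (of_nat q)) (nonzero_tuples d)"
proof -
  define c c' where "c = cofactor (of_nat q)" and "c' = deriv cofactor (of_nat q)"
  have c: "(cofactor has_field_derivative c') (at (of_nat q))"
    unfolding c'_def by (rule holomorphic_derivI[OF cofactor_holomorphic[of UNIV]]) auto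
  have quot: "((\<lambda>\<alpha>. f \<alpha> / cofactor \<alpha>) has_field_derivative
      deriv f (of_nat q) * (1 / c) - f (of_nat q) * (c' / (c * c))) (at (of_nat q))"
    if "f holomorphic_on {\<alpha>. Re \<alpha> > real d - real (Suc K)}" for f
  proof -
    have "(f has_field_derivative deriv f (of_nat q)) (at (of_nat q))"
      by (rule holomorphic_derivI[OF that open_Re_gt]) (use Re_q in simp)
    from DERIV_divide[OF this c cofactor_neq_0] show ?thesis
      using cofactor_neq_0 by (auto simp: c_def field_simps elim!: DERIV_cong)
  qed
  have "tail_fp (dotp d n w) = deriv (\<lambda>\<alpha>. tail K \<alpha> (dotp d n w)) (of_nat q) * (1 / c) -
          tail K (of_nat q) (dotp d n w) * (c' / (c * c))" if "n \<in> nonzero_tuples d" for n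
    by (rule DERIV_unique[OF DERIV_tail_div_cofactor[OF dotp_in_H[OF that]] quot[OF tail_holomorphic]])
  moreover have "((\<lambda>n. deriv (\<lambda>\<alpha>. tail K \<alpha> (dotp d n w)) (of_nat q) * (1 / c) -
          tail K (of_nat q) (dotp d n w) * (c' / (c * c))) has_sum
        (deriv (tail_sum K) (of_nat q) * (1 / c) - tail_sum K (of_nat q) * (c' / (c * c)))) (nonzero_tuples d)"
    by (intro has_sum_diff has_sum_cmult_left tail_sum Re_q)
  ultimately show ?thesis
    unfolding DERIV_imp_deriv[OF quot[OF tail_sum(1)]] by (subst has_sum_cong) auto
qed

lemma finite_part_conv_fp:
  "finite_part (barnes_zeta_hom lg d w) (of_nat q) = (\<Sum>\<^sub>\<infinity>n\<in>nonzero_tuples d. tail_fp (dotp d n w)) - boundary_fp"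
proof -
  have "(\<lambda>\<alpha>. tail_sum K \<alpha> / cofactor \<alpha>) field_differentiable at (of_nat q)"
  proof (rule field_differentiable_divide)
    show "tail_sum K field_differentiable at (of_nat q)"
      by (rule holomorphic_on_imp_differentiable_at[OF tail_sum(1) open_Re_gt]) (use Re_q in simp)
    show "cofactor field_differentiable at (of_nat q)"
      by (rule holomorphic_on_imp_differentiable_at[OF cofactor_holomorphic[of UNIV]]) auto
  qed (rule cofactor_neq_0)
  hence "((\<lambda>\<alpha>. tail_sum K \<alpha> / cofactor \<alpha>) has_field_derivative deriv (\<lambda>\<alpha>. tail_sum K \<alpha> / cofactor \<alpha>) (of_nat q)) (at (of_nat q))"
    by (simp add: field_differentiable_derivI)
  from DERIV_diff[OF this DERIV_boundary_div_cofactor]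
  have "deriv (\<lambda>\<alpha>. E K \<alpha> / cofactor \<alpha>) (of_nat q) = deriv (\<lambda>\<alpha>. tail_sum K \<alpha> / cofactor \<alpha>) (of_nat q) - boundary_fp"
    unfolding E_def diff_divide_distrib by (rule DERIV_imp_deriv)
  also have "deriv (\<lambda>\<alpha>. tail_sum K \<alpha> / cofactor \<alpha>) (of_nat q) = (\<Sum>\<^sub>\<infinity>n\<in>nonzero_tuples d. tail_fp (dotp d n w))"
    using has_sum_tail_fp by (rule infsumI[symmetric])
  finally show ?thesis by (simp only: finite_part_eq)
qed

section \<open>Explicit evaluation of the finite parts\<close>

lemma K_less_d: "K < d"
  using q by (auto simp: K_def)

lemma minus_one_power_q: "(- 1) ^ q = - ((- 1) ^ (q - 1) :: complex)"
  using q by (cases q) auto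

text \<open>The harmonic terms of \<open>hp_fp\<close> multiply powers of degree K - m < d, which
  \<open>G_op\<close> annihilates; only the logarithmic terms remain.\<close>

lemma tail_fp_eq:
  "tail_fp y = 1 / y ^ q + (- 1) ^ q / fact (q - 1) *
     (\<Sum>m\<le>K. fps_nth (recip_fps d w) m / fact (K - m) * G_op d (\<lambda>x. (y + x) ^ (K - m) * lg (y + x)) w)"
proof -
  have "G_op d (\<lambda>x. hp_fp m (y + x)) w = (- 1) ^ (q - 1) / (fact (q - 1) * fact (K - m)) *
          G_op d (\<lambda>x. (y + x) ^ (K - m) * lg (y + x)) w" for m
    unfolding hp_fp_def G_op_cmult G_op_diff using K_less_d by (simp add: G_op_power_eq_0)
  thus ?thesis
    by (simp add: tail_fp_def minus_one_power_q sum_distrib_left sum_negf mult_ac)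
qed

text \<open>\<open>F_op\<close> lacks the empty set, so it sends x^k with k < d to minus the missing
  term (-1)^d * 0^k. This is nonzero only for k = 0, i.e. m = K, where \<open>harm 0\<close> is 0:
  hence the single extra term with \<open>harm (q - 1)\<close>.\<close>

lemma boundary_fp_eq:
  "- boundary_fp = (- 1) ^ q / fact (q - 1) *
       (\<Sum>m\<le>K. fps_nth (recip_fps d w) m / fact (K - m) * F_op d (\<lambda>x. x ^ (K - m) * lg x) w)
     + fps_nth (recip_fps d w) K * (- 1) ^ (d + q + 1) / fact (q - 1) * harm (q - 1)"
proof -
  let ?u = "fps_nth (recip_fps d w)"
  define s :: complex where "s = (- 1) ^ (q - 1) / fact (q - 1)"
  have pow: "F_op d (\<lambda>x. x ^ (K - m)) w = - ((- 1) ^ d * 0 ^ (K - m))" for m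
    using G_op_power_eq_0[of "K - m" d 0 w] K_less_d by (simp add: F_op_conv_G_op)
  have F: "?u m * F_op d (hp_fp m) w = s * (?u m / fact (K - m) * F_op d (\<lambda>x. x ^ (K - m) * lg x) w) +
      (if m = K then - s * ?u K * harm (q - 1) * (- 1) ^ d else 0)" if "m \<le> K" for m
  proof -
    have eq: "F_op d (hp_fp m) w = s / fact (K - m) *
      (F_op d (\<lambda>x. x ^ (K - m) * lg x) w + (harm (K - m) - harm (q - 1)) * ((- 1) ^ d * 0 ^ (K - m)))"
      unfolding hp_fp_def[abs_def] F_op_cmult F_op_diff pow by (simp add: s_def)
    show ?thesis
    proof (cases "m = K")
      case True
      have "harm 0 = (0 :: complex)" by (simp add: harm_def)
      thus ?thesis by (subst eq) (simp add: True algebra_simps)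
    next
      case False
      hence "K - m > 0" using that by simp
      thus ?thesis by (subst eq) (simp add: False)
    qed
  qed
  have "boundary_fp = (\<Sum>m\<le>K. s * (?u m / fact (K - m) * F_op d (\<lambda>x. x ^ (K - m) * lg x) w) +
      (if m = K then - s * ?u K * harm (q - 1) * (- 1) ^ d else 0))"
    unfolding boundary_fp_def by (intro sum.cong refl F) simp
  also have "\<dots> = s * (\<Sum>m\<le>K. ?u m / fact (K - m) * F_op d (\<lambda>x. x ^ (K - m) * lg x) w)
      - s * ?u K * harm (q - 1) * (- 1) ^ d"
    by (simp add: sum.distrib sum_distrib_left)
  finally show ?thesis
    by (simp add: s_def minus_one_power_q power_add)
qed

lemma finite_part_barnes:
  defines "c \<equiv> \<lambda>m. (deriv ^^ d) (bernoullian d w m) 0"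
  defines "t \<equiv> \<lambda>n. 1 / dotp d n w ^ q
                 + (-1) ^ q / fact (q - 1) *
                   (\<Sum>m=0..d-q. c m / (fact m * fact (d - q - m)) *
                      G_op d (\<lambda>x. (dotp d n w + x) ^ (d - q - m) * lg (dotp d n w + x)) w)"
  shows "(\<lambda>n. norm (t n)) summable_on nonzero_tuples d"
    and "finite_part (barnes_zeta_hom lg d w) (of_nat q) =
              (-1) ^ q / fact (q - 1) *
                (\<Sum>m=0..d-q. c m / (fact m * fact (d - q - m)) *
                   F_op d (\<lambda>x. x ^ (d - q - m) * lg x) w)
              + c (d - q) * (-1) ^ (d + q + 1) / (fact (q - 1) * fact (d - q)) * harm (q - 1)
              + (\<Sum>\<^sub>\<infinity>n\<in>nonzero_tuples d. t n)"
proof -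
  have c: "c m = fact m * fps_nth (recip_fps d w) m" for m
    unfolding c_def by (rule higher_deriv_bernoullian[OF w_neq_0 d_pos])
  have c': "c m / (fact m * fact k) = fps_nth (recip_fps d w) m / fact k" for m k
    by (simp add: c)
  have t: "t = (\<lambda>n. tail_fp (dotp d n w))"
    unfolding t_def c' tail_fp_eq K_def by (simp add: atLeast0AtMost)
  show "(\<lambda>n. norm (t n)) summable_on nonzero_tuples d"
    \<comment> \<open>For complex terms, convergence of an unordered sum is already absolute
      convergence.\<close>
    unfolding t by (rule iffD1[OF summable_on_iff_abs_summable_on_complex has_sum_imp_summable[OF has_sum_tail_fp]])
  show "finite_part (barnes_zeta_hom lg d w) (of_nat q) =
              (-1) ^ q / fact (q - 1) *
                (\<Sum>m=0..d-q. c m / (fact m * fact (d - q - m)) *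
                   F_op d (\<lambda>x. x ^ (d - q - m) * lg x) w)
              + c (d - q) * (-1) ^ (d + q + 1) / (fact (q - 1) * fact (d - q)) * harm (q - 1)
              + (\<Sum>\<^sub>\<infinity>n\<in>nonzero_tuples d. t n)"
    using boundary_fp_eq
    unfolding c' t finite_part_conv_fp K_def[symmetric] by (simp add: c atLeast0AtMost)
qed

end

theorem mainTheorem5:
  fixes \<theta> :: real and lg :: "complex \<Rightarrow> complex"
    and d q :: nat and w :: "nat \<Rightarrow> complex"
  assumes "log_branch_on lg (half_plane \<theta>)"
    and "d \<ge> 1"
    and "\<And>i. i \<in> {1..d} \<Longrightarrow> w i \<in> half_plane \<theta>"
    and "q \<in> {1..d}"
  shows "let c = (\<lambda>m. (deriv ^^ d) (bernoullian d w m) 0);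
             t = (\<lambda>n. 1 / dotp d n w ^ q
                 + (-1) ^ q / fact (q - 1) *
                   (\<Sum>m=0..d-q. c m / (fact m * fact (d - q - m)) *
                      G_op d (\<lambda>x. (dotp d n w + x) ^ (d - q - m) * lg (dotp d n w + x)) w))
         in (\<lambda>n. norm (t n)) summable_on nonzero_tuples d \<and>
            finite_part (barnes_zeta_hom lg d w) (of_nat q) =
              (-1) ^ q / fact (q - 1) *
                (\<Sum>m=0..d-q. c m / (fact m * fact (d - q - m)) *
                   F_op d (\<lambda>x. x ^ (d - q - m) * lg x) w)
              + c (d - q) * (-1) ^ (d + q + 1) / (fact (q - 1) * fact (d - q)) * harm (q - 1)
              + (\<Sum>\<^sub>\<infinity>n\<in>nonzero_tuples d. t n)"
proof -
  interpret barnes_pole \<theta> lg d w q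
    using assms by unfold_locales auto
  show ?thesis
    unfolding Let_def by (intro conjI finite_part_barnes)
qed

end
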